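(* Assume the setting described in the context. Let $\rho(\mu):=\min\{\mathrm{Ch}(\mu_{\hat a},\mu_{a^*}),\ \min_{a\in A^-\setminus\{\hat a\}}\mathrm{KL}(\mu_a,\mu_{a^*})\}$. Then under both general and binary contracts the second-best cost converges to the first-best cost exponentially at rate $\rho(\mu)$: $$C^{\mathrm{SB}}_n(\mu,u,c,a^* )-C^{\mathrm{FB}}(u,c,a^* )=\exp[-\rho(\mu)n+o(n)],\qquad C^{\mathrm{bin}}_n(\mu,u,c,a^* )-C^{\mathrm{FB}}(u,c,a^* )=\exp[-\rho(\mu)n+o(n)].$$
   Context: Finite action set $A$, target $a^*\in A$. Monitoring technology $\mu=(\mu_a)_{a\in A}$: Borel probability measures on a signal space $X$ (subset of a Euclidean space), pairwise distinct, $\mu_{a'}\ll\mu_a$ for all $a,a'$, $\int(\frac{d\mu_{a'}}{d\mu_a})^\lambda d\mu_a<\infty$ for all $\lambda>0$. Under action $a$ the principal observes $n$ i.i.d. draws $x^n$ from $\mu_a$ (expectation $\mathbb{E}_a$). $\underline w\in\mathbb{R}$; $u:[\underline w,\infty)\to\mathbb{R}$ is $C^2$ with $u'>0$, $u''<0$, $\lim_{w\to\infty}u'(w)=0$; $c:A\to\mathbb{R}$ with $c(a^* )>c(a)$ for some $a$ and $c(a^* )\neq c(a)$ for all $a\neq a^*$; outside option $0$. There is a unique minimizer $\hat a$ of $c$ on $A$, and $c(\hat a)\le u(\underline w)$; also $u(\underline w)+c(a^* )-c(\hat a)<\lim_{w\to\infty}u(w)$. Let $h=u^{-1}$. A contract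 $w:X^n\to[\underline w,\infty)$ satisfies (IC) if $\mathbb{E}_{a^*}[u(w)]-c(a^* )\ge\mathbb{E}_a[u(w)]-c(a)$ for all $a\in A$ and (IR) if $\mathbb{E}_{a^*}[u(w)]-c(a^* )\ge0$. $C^{\mathrm{SB}}_n$ is the infimum of $\mathbb{E}_{a^*}[w(x^n)]$ over contracts satisfying (IC),(IR); $C^{\mathrm{bin}}_n$ the same over contracts with $|w(X^n)|=2$. First-best cost: $C^{\mathrm{FB}}(u,c,a^* )=h(u(\underline w)+c(a^* )-c(\hat a))$. $A^-=\{a:c(a)<c(a^* )\}$; a minimum over the empty set is $+\infty$. $\mathrm{KL}(\nu,\nu')=\int\log\frac{d\nu}{d\nu'}d\nu$ if $\nu\ll\nu'$, else $\infty$; $\mathrm{Ch}(\nu_1,\nu_2)=\min_{\nu\in\Delta(X)}\max\{\mathrm{KL}(\nu,\nu_1),\mathrm{KL}(\nu,\nu_2)\}$. $f(n)=\exp[-rn+o(n)]$ means $\frac1n\log f(n)\to-r$. *)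

theory Defs
  imports "HOL-Probability.Probability"
begin

text \<open>Kullback-Leibler divergence KL(nu, nu') (natural logarithm), extended-real valued:
  equal to the integral of log(d nu / d nu') w.r.t. nu when nu is absolutely continuous
  w.r.t. nu', and +infinity otherwise.  When nu << nu' the negative part of the integrand is
  always integrable, so non-integrability means the integral is +infinity.\<close>
definition KL :: "'x measure \<Rightarrow> 'x measure \<Rightarrow> ereal" where
  "KL \<nu> \<nu>' =
     (if absolutely_continuous \<nu>' \<nu> \<and> sets \<nu> = sets \<nu>' then
        (if integrable \<nu> (\<lambda>x. ln (enn2real (RN_deriv \<nu>' \<nu> x)))
         then ereal (\<integral>x. ln (enn2real (RN_deriv \<nu>' \<nu> x)) \<partial>\<nu>)
         else \<infinity>)
      else \<infinity>)"

definition prob_measures_on :: "('x::euclidean_space) set \<Rightarrow> 'x measure set" where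
  "prob_measures_on X = {\<nu>. prob_space \<nu> \<and> sets \<nu> = sets (restrict_space borel X)}"

text \<open>Chernoff information (the minimum is attained; we write it as an infimum).\<close>
definition Chernoff :: "('x::euclidean_space) set \<Rightarrow> 'x measure \<Rightarrow> 'x measure \<Rightarrow> ereal" where
  "Chernoff X \<nu>1 \<nu>2 = (INF \<nu>\<in>prob_measures_on X. max (KL \<nu> \<nu>1) (KL \<nu> \<nu>2))"

text \<open>The rate rho(mu).  A minimum over the empty set is +infinity (ereal Inf {} = infinity).\<close>
definition rate :: "('x::euclidean_space) set \<Rightarrow> 'a set \<Rightarrow> ('a \<Rightarrow> 'x measure) \<Rightarrow> ('a \<Rightarrow> real)
    \<Rightarrow> 'a \<Rightarrow> 'a \<Rightarrow> ereal" where
  "rate X A \<mu> c as ah =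
     min (Chernoff X (\<mu> ah) (\<mu> as))
         (INF a\<in>{a\<in>A. c a < c as} - {ah}. KL (\<mu> a) (\<mu> as))"

definition signals :: "('a \<Rightarrow> 'x measure) \<Rightarrow> 'a \<Rightarrow> nat \<Rightarrow> (nat \<Rightarrow> 'x) measure" where
  "signals \<mu> a n = PiM {..<n} (\<lambda>_. \<mu> a)"

text \<open>Contracts w : X^n -> [wl, infinity) satisfying (IC) and (IR).  Expectations are required
  to exist (finite): E_a[u(w)] for every action a, and E_{a*}[w] (contracts with infinite
  expected wage do not affect the infimum).\<close>
definition feasible :: "'a set \<Rightarrow> ('a \<Rightarrow> 'x measure) \<Rightarrow> real \<Rightarrow> (real \<Rightarrow> real) \<Rightarrow> ('a \<Rightarrow> real)
    \<Rightarrow> 'a \<Rightarrow> nat \<Rightarrow> ((nat \<Rightarrow> 'x) \<Rightarrow> real) set" where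
  "feasible A \<mu> wl u c as n =
     {w. w \<in> borel_measurable (signals \<mu> as n)
       \<and> (\<forall>x\<in>space (signals \<mu> as n). wl \<le> w x)
       \<and> (\<forall>a\<in>A. integrable (signals \<mu> a n) (\<lambda>x. u (w x)))
       \<and> integrable (signals \<mu> as n) w
       \<and> (\<forall>a\<in>A. (\<integral>x. u (w x) \<partial>signals \<mu> as n) - c as \<ge> (\<integral>x. u (w x) \<partial>signals \<mu> a n) - c a)
       \<and> (\<integral>x. u (w x) \<partial>signals \<mu> as n) - c as \<ge> 0}"

definition feasible_bin :: "'a set \<Rightarrow> ('a \<Rightarrow> 'x measure) \<Rightarrow> real \<Rightarrow> (real \<Rightarrow> real) \<Rightarrow> ('a \<Rightarrow> real)
    \<Rightarrow> 'a \<Rightarrow> nat \<Rightarrow> ((nat \<Rightarrow> 'x) \<Rightarrow> real) set" where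
  "feasible_bin A \<mu> wl u c as n =
     {w \<in> feasible A \<mu> wl u c as n. card (w ` space (signals \<mu> as n)) = 2}"

definition C_SB :: "'a set \<Rightarrow> ('a \<Rightarrow> 'x measure) \<Rightarrow> real \<Rightarrow> (real \<Rightarrow> real) \<Rightarrow> ('a \<Rightarrow> real)
    \<Rightarrow> 'a \<Rightarrow> nat \<Rightarrow> real" where
  "C_SB A \<mu> wl u c as n = Inf ((\<lambda>w. \<integral>x. w x \<partial>signals \<mu> as n) ` feasible A \<mu> wl u c as n)"

definition C_bin :: "'a set \<Rightarrow> ('a \<Rightarrow> 'x measure) \<Rightarrow> real \<Rightarrow> (real \<Rightarrow> real) \<Rightarrow> ('a \<Rightarrow> real)
    \<Rightarrow> 'a \<Rightarrow> nat \<Rightarrow> real" where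
  "C_bin A \<mu> wl u c as n = Inf ((\<lambda>w. \<integral>x. w x \<partial>signals \<mu> as n) ` feasible_bin A \<mu> wl u c as n)"

definition C_FB :: "real \<Rightarrow> (real \<Rightarrow> real) \<Rightarrow> ('a \<Rightarrow> real) \<Rightarrow> 'a \<Rightarrow> 'a \<Rightarrow> real" where
  "C_FB wl u c as ah = the_inv_into {wl..} u (u wl + c as - c ah)"

end

theory Submission
  imports Defs
begin

text \<open>
  Let \<open>B\<close> be the event that the wage stays clearly below the first-best wage. Strict concavity of
  \<open>u\<close> makes \<open>B\<close> costly, and incentive compatibility against \<open>ah\<close> charges the probability of the
  complement of \<open>B\<close> under \<open>ah\<close>, so the excess over the first-best cost is at least a constant times
  the sum of the two error probabilities of the test \<open>B\<close> of \<open>as\<close> against \<open>ah\<close>. For any other cheaper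
  action \<open>a\<close>, incentive compatibility forces the probability of \<open>B\<close> under \<open>a\<close> to stay bounded away
  from zero unless the excess is already large. Changing measure to an arbitrary \<open>\<nu>\<close> (respectively to
  \<open>\<mu> a\<close>) and using the weak law of large numbers turns these facts into Chernoff's and Stein's lower
  bounds.

  Conversely, intersect the likelihood ratio test of \<open>as\<close> against \<open>ah\<close> with the Stein tests
  against the other cheaper actions and pay a bonus exactly on that event, calibrated so that the
  incentive constraint for \<open>ah\<close> binds. The excess of this two-wage contract is of the order of the
  two error probabilities.
\<close>

section \<open>Independent samples and the weak law of large numbers\<close>

text \<open>Only the incentive constraint against \<open>ah\<close> binds at the first best, since
  \<open>u W - u wl\<close> equals \<open>c as - c ah\<close>. Any probability of a high wage under
  \<open>ah\<close> must therefore be paid for at first order, and both error probabilities carry an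
  exponent. Against another cheaper action \<open>a\<close> there is the slack
  \<open>c a - c ah > 0\<close>, which absorbs a fixed probability of a high wage under
  \<open>a\<close>: that error only has to vanish, at no prescribed speed, and the exponent sits on
  the error under \<open>as\<close> alone, which is Stein's setting.

  The Chernoff information is never evaluated. It is bounded above by \<open>- ln (mgf s)\<close> at
  the minimizer \<open>s\<close>, tests reach every exponent below that number, and the cost lower
  bound holds for every exponent above the rate, so the two bounds meet without an identity.

  Moments are given for positive powers of the likelihood ratio only, so difference quotients of
  \<open>mgf\<close> are dominated at points \<open>s > 0\<close>, with steps of size at most
  \<open>s / 4\<close>.\<close>

abbreviation iid :: "'x measure \<Rightarrow> nat \<Rightarrow> (nat \<Rightarrow> 'x) measure" where
  "iid M n \<equiv> PiM {..<n} (\<lambda>_. M)"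

lemma prob_space_iid: "prob_space M \<Longrightarrow> prob_space (iid M n)"
  by (rule prob_space_PiM)

lemma indep_vars_iid:
  fixes g :: "'x \<Rightarrow> real"
  assumes "prob_space M" and [measurable]: "g \<in> borel_measurable M"
  shows "prob_space.indep_vars (iid M n) (\<lambda>_. borel) (\<lambda>i x. g (x i)) {..<n}"
proof (cases "n = 0")
  \<comment> \<open>The description of independence through the joint law needs a nonempty index
    set, so the empty sample is treated apart.\<close>
  case True
  interpret P: prob_space "iid M n" by (rule prob_space_iid) fact
  show ?thesis unfolding P.indep_vars_def P.indep_sets_def using True by auto
next
  case False
  interpret M: prob_space M by fact
  interpret P: prob_space "iid M n" by (rule prob_space_iid) fact
  have D: "distr (iid M n) M (\<lambda>x. x i) = M" if "i < n" for i
    using distr_PiM_component[of "{..<n}" "\<lambda>_. M" i] that assms(1) by auto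
  have "P.indep_vars (\<lambda>_. M) (\<lambda>i x. x i) {..<n}"
  proof (subst P.indep_vars_iff_distr_eq_PiM')
    have "distr (iid M n) (iid M n) (\<lambda>x. \<lambda>i\<in>{..<n}. x i) = distr (iid M n) (iid M n) (\<lambda>x. x)"
      by (intro distr_cong) (auto simp: space_PiM PiE_def extensional_restrict)
    also have "\<dots> = iid M n" by (simp add: distr_id2)
    also have "\<dots> = (\<Pi>\<^sub>M i\<in>{..<n}. distr (iid M n) M (\<lambda>x. x i))"
      by (intro PiM_cong) (auto simp: D)
    finally show "distr (iid M n) (iid M n) (\<lambda>x. \<lambda>i\<in>{..<n}. x i) = (\<Pi>\<^sub>M i\<in>{..<n}. distr (iid M n) M (\<lambda>x. x i))" .
  qed (use False in auto)
  then show ?thesis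
    by (rule P.indep_vars_compose2) auto
qed

lemma integrable_iid_component:
  fixes g :: "'x \<Rightarrow> real"
  assumes "prob_space M" "integrable M g" "i < n"
  shows "integrable (iid M n) (\<lambda>x. g (x i))"
    and "(\<integral>x. g (x i) \<partial>iid M n) = (\<integral>x. g x \<partial>M)"
proof -
  have D: "distr (iid M n) M (\<lambda>x. x i) = M"
    using distr_PiM_component[of "{..<n}" "\<lambda>_. M" i] assms by auto
  have m: "(\<lambda>x. x i) \<in> measurable (iid M n) M" using assms(3) by simp
  have g: "g \<in> borel_measurable M" using assms(2) by auto
  have "integrable (distr (iid M n) M (\<lambda>x. x i)) g" using assms(2) unfolding D .
  then show "integrable (iid M n) (\<lambda>x. g (x i))"
    by (rule integrable_distr[OF m])
  have "(\<integral>x. g (x i) \<partial>iid M n) = integral\<^sup>L (distr (iid M n) M (\<lambda>x. x i)) g"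
    by (rule integral_distr[OF m g, symmetric])
  then show "(\<integral>x. g (x i) \<partial>iid M n) = (\<integral>x. g x \<partial>M)" unfolding D .
qed

text \<open>Boxes determine a finite product measure, and on a box both sides factor over the
  coordinates.\<close>

lemma iid_density:
  fixes r :: "'x \<Rightarrow> real"
  assumes P: "prob_space P" and Q: "prob_space Q"
    and [measurable]: "r \<in> borel_measurable P" and r0: "\<And>x. r x \<ge> 0"
    and Qd: "Q = density P r"
  shows "iid Q n = density (iid P n) (\<lambda>x. ennreal (\<Prod>i<n. r (x i)))"
proof -
  interpret P: prob_space P by fact
  interpret Q: prob_space Q by fact
  interpret PP: product_sigma_finite "\<lambda>_::nat. P" by standard
  interpret QQ: product_sigma_finite "\<lambda>_::nat. Q" by standard
  have setsPQ: "sets (iid Q n) = sets (iid P n)"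
    by (intro sets_PiM_cong) (auto simp: Qd)
  show ?thesis
  proof (rule QQ.PiM_eqI[symmetric])
    fix A assume A: "\<And>i. i \<in> {..<n} \<Longrightarrow> A i \<in> sets Q"
    have A' [measurable]: "A i \<in> sets P" if "i < n" for i using A[of i] that by (simp add: Qd)
    have S: "Pi\<^sub>E {..<n} A \<in> sets (iid P n)" by (intro sets_PiM_I_finite) auto
    have "emeasure (density (iid P n) (\<lambda>x. ennreal (\<Prod>i<n. r (x i)))) (Pi\<^sub>E {..<n} A)
      = (\<integral>\<^sup>+x. ennreal (\<Prod>i<n. r (x i)) * indicator (Pi\<^sub>E {..<n} A) x \<partial>iid P n)"
      using S by (intro emeasure_density) auto
    also have "\<dots> = (\<integral>\<^sup>+x. (\<Prod>i<n. ennreal (r (x i)) * indicator (A i) (x i)) \<partial>iid P n)"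
    proof (intro nn_integral_cong)
      fix x assume x: "x \<in> space (iid P n)"
      have ind: "(indicator (Pi\<^sub>E {..<n} A) x :: ennreal) = (\<Prod>i<n. indicator (A i) (x i))"
      proof (cases "x \<in> Pi\<^sub>E {..<n} A")
        case True then show ?thesis by (auto simp: PiE_def Pi_def intro!: prod.neutral[symmetric])
      next
        case False
        then obtain i where "i < n" "x i \<notin> A i" using x by (auto simp: space_PiM PiE_def Pi_def)
        then show ?thesis using False by (auto intro!: prod_zero[symmetric] bexI[of _ i])
      qed
      show "ennreal (\<Prod>i<n. r (x i)) * indicator (Pi\<^sub>E {..<n} A) x
         = (\<Prod>i<n. ennreal (r (x i)) * indicator (A i) (x i))"
        unfolding ind prod.distrib using r0 by (simp add: prod_ennreal)
    qed
    also have "\<dots> = (\<Prod>i<n. (\<integral>\<^sup>+x. ennreal (r x) * indicator (A i) x \<partial>P))"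
      by (rule PP.product_nn_integral_prod) auto
    also have "\<dots> = (\<Prod>i<n. emeasure Q (A i))"
      by (intro prod.cong refl) (auto simp: Qd emeasure_density)
    finally show "emeasure (density (iid P n) (\<lambda>x. ennreal (\<Prod>i<n. r (x i)))) (Pi\<^sub>E {..<n} A) = (\<Prod>i<n. emeasure Q (A i))" .
  qed (auto simp: setsPQ)
qed

text \<open>Each summand ranges over an interval of length \<open>2 * C\<close>, so Hoeffding's
  exponent \<open>-2 * (n * e)^2 / (n * (2 * C)^2)\<close> reduces to the stated one.\<close>

lemma tail_bound_bounded_iid:
  fixes g :: "'x \<Rightarrow> real"
  assumes M: "prob_space M" and [measurable]: "g \<in> borel_measurable M"
    and bd: "\<And>x. \<bar>g x\<bar> \<le> C" and C: "C > 0" and n: "n > 0" and e: "e \<ge> 0"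
  shows "measure (iid M n) {x\<in>space (iid M n). (\<Sum>i<n. g (x i)) \<ge> real n * ((\<integral>x. g x \<partial>M) + e)}
    \<le> exp (- (e\<^sup>2 / (2 * C\<^sup>2)) * real n)"
proof -
  interpret M: prob_space M by fact
  interpret P: prob_space "iid M n" by (rule prob_space_iid) fact
  have int: "integrable M g" by (rule M.integrable_const_bound[where B=C]) (use bd in auto)
  interpret H: Hoeffding_ineq "iid M n" "{..<n}" "\<lambda>i x. g (x i)" "\<lambda>_. -C" "\<lambda>_. C"
    "\<Sum>i<n. P.expectation (\<lambda>x. g (x i))"
  proof unfold_locales
    show "P.indep_vars (\<lambda>_. borel) (\<lambda>i x. g (x i)) {..<n}" by (rule indep_vars_iid) (use M in auto)
  qed (use bd in \<open>auto simp: abs_le_iff minus_le_iff\<close>)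
  have mu: "(\<Sum>i<n. P.expectation (\<lambda>x. g (x i))) = real n * (\<integral>x. g x \<partial>M)"
    using integrable_iid_component(2)[OF M int, of _ n] by simp
  have "P.prob {x\<in>space (iid M n). (\<Sum>i<n. g (x i)) \<ge> real n * (\<integral>x. g x \<partial>M) + real n * e}
    \<le> exp (-2 * (real n * e)\<^sup>2 / (\<Sum>i<n. (C - (-C))\<^sup>2))"
    using H.Hoeffding_ineq_ge[of "real n * e"] e n C unfolding mu by simp
  also have "-2 * (real n * e)\<^sup>2 / (\<Sum>i<n. (C - (-C))\<^sup>2) = - (e\<^sup>2 / (2 * C\<^sup>2)) * real n"
    using n C by (simp add: power2_eq_square field_simps)
  finally show ?thesis by (simp add: distrib_left)
qed

text \<open>Only a first moment is assumed: the bounded part of a truncation is controlled by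
  Hoeffding's inequality and the remainder by Markov's.\<close>
lemma weak_law_upper:
  fixes g :: "'x \<Rightarrow> real"
  assumes M: "prob_space M" and g: "integrable M g" and t: "t > (\<integral>x. g x \<partial>M)"
  shows "(\<lambda>n. measure (iid M n) {x\<in>space (iid M n). (\<Sum>i<n. g (x i)) \<ge> real n * t}) \<longlonglongrightarrow> 0"
proof (rule LIMSEQ_I)
  fix d :: real assume d: "d > 0"
  interpret M: prob_space M by fact
  note [measurable] = borel_measurable_integrable[OF g]
  \<comment> \<open>The margin is cut in four: the bias of the truncation, the Hoeffding deviation
    and the remainder take at most \<open>e\<close> each, and one \<open>e\<close> is spare.\<close>
  define e where "e = (t - (\<integral>x. g x \<partial>M)) / 4"
  have e: "e > 0" using t by (simp add: e_def)
  have te: "t = (\<integral>x. g x \<partial>M) + 4 * e" by (simp add: e_def field_simps)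
  define b where "b C x = max (-C) (min C (g x))" for C x
  have [measurable]: "b C \<in> borel_measurable M" for C unfolding b_def by simp
  have "(\<lambda>k. \<integral>x. \<bar>g x - b (real k) x\<bar> \<partial>M) \<longlonglongrightarrow> (\<integral>x. 0 \<partial>M)"
  proof (rule integral_dominated_convergence[where w="\<lambda>x. \<bar>g x\<bar>"])
    show "AE x in M. (\<lambda>k. \<bar>g x - b (real k) x\<bar>) \<longlonglongrightarrow> 0"
    proof (rule AE_I2)
      fix x
      obtain N where N: "\<bar>g x\<bar> \<le> real N" using real_arch_simple by blast
      have "eventually (\<lambda>k. \<bar>g x - b (real k) x\<bar> = 0) sequentially"
        using eventually_ge_at_top[of N]
        by eventually_elim (use N in \<open>auto simp: b_def\<close>)
      then show "(\<lambda>k. \<bar>g x - b (real k) x\<bar>) \<longlonglongrightarrow> 0" by (rule tendsto_eventually)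
    qed
    show "AE x in M. norm \<bar>g x - b (real k) x\<bar> \<le> \<bar>g x\<bar>" for k
      by (rule AE_I2) (auto simp: b_def)
  qed (use g in auto)
  \<comment> \<open>The bound by \<open>e\<close> controls the bias of the truncation; the bound by
    \<open>e * d / 2\<close> makes Markov's inequality for the remainder give at most
    \<open>d / 2\<close>.\<close>
  then have "eventually (\<lambda>k. (\<integral>x. \<bar>g x - b (real k) x\<bar> \<partial>M) < min e (e * d / 2)) sequentially"
    using e d by (intro order_tendstoD(2)) (auto simp: min_def)
  then have "eventually (\<lambda>k. k > 0 \<and> (\<integral>x. \<bar>g x - b (real k) x\<bar> \<partial>M) < min e (e * d / 2)) sequentially"
    using eventually_gt_at_top[of 0] by eventually_elim auto
  then obtain k where k: "k > 0" "(\<integral>x. \<bar>g x - b (real k) x\<bar> \<partial>M) < min e (e * d / 2)"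
    using eventually_happens'[OF sequentially_bot] by blast
  define C where "C = real k"
  have C: "C > 0" using k by (simp add: C_def)
  define h where "h x = \<bar>g x - b C x\<bar>" for x
  have [measurable]: "h \<in> borel_measurable M" unfolding h_def by simp
  have inth: "integrable M h" unfolding h_def
    by (rule Bochner_Integration.integrable_bound[OF g]) (auto simp: b_def C_def)
  have Eh: "(\<integral>x. h x \<partial>M) < min e (e * d / 2)" using k(2) by (simp add: h_def C_def)
  have bd: "\<bar>b C x\<bar> \<le> C" for x using C by (auto simp: b_def)
  have intb: "integrable M (b C)" by (rule M.integrable_const_bound[where B=C]) (use bd in auto)
  have "(\<integral>x. b C x \<partial>M) \<le> (\<integral>x. g x + h x \<partial>M)"
    by (rule integral_mono) (use intb inth g in \<open>auto simp: h_def\<close>)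
  then have Eb: "(\<integral>x. b C x \<partial>M) \<le> (\<integral>x. g x \<partial>M) + e" using Eh inth g by simp
  have key: "measure (iid M n) {x\<in>space (iid M n). (\<Sum>i<n. g (x i)) \<ge> real n * t}
     \<le> exp (- (e\<^sup>2 / (2 * C\<^sup>2)) * real n) + d / 2" if n: "n > 0" for n
  proof -
    interpret P: prob_space "iid M n" by (rule prob_space_iid) fact
    let ?B = "{x\<in>space (iid M n). (\<Sum>i<n. b C (x i)) \<ge> real n * ((\<integral>x. b C x \<partial>M) + e)}"
    let ?H = "{x\<in>space (iid M n). (\<Sum>i<n. h (x i)) \<ge> real n * e}"
    have "measure (iid M n) {x\<in>space (iid M n). (\<Sum>i<n. g (x i)) \<ge> real n * t}
      \<le> P.prob (?B \<union> ?H)"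
    proof (rule P.finite_measure_mono)
      show "{x\<in>space (iid M n). (\<Sum>i<n. g (x i)) \<ge> real n * t} \<subseteq> ?B \<union> ?H"
      proof
        fix x assume "x \<in> {x\<in>space (iid M n). (\<Sum>i<n. g (x i)) \<ge> real n * t}"
        then have x: "x \<in> space (iid M n)" "(\<Sum>i<n. g (x i)) \<ge> real n * t" by auto
        have 1: "(\<Sum>i<n. g (x i)) \<le> (\<Sum>i<n. b C (x i)) + (\<Sum>i<n. h (x i))"
          unfolding sum.distrib[symmetric] by (intro sum_mono) (auto simp: h_def)
        have "real n * ((\<integral>x. b C x \<partial>M) + e) + real n * e \<le> real n * t"
          unfolding distrib_left[symmetric] using Eb e te by (intro mult_left_mono) auto
        then show "x \<in> ?B \<union> ?H" using x 1 by auto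
      qed
    qed measurable
    also have "\<dots> \<le> P.prob ?B + P.prob ?H" by (rule measure_Un_le) measurable
    also have "P.prob ?B \<le> exp (- (e\<^sup>2 / (2 * C\<^sup>2)) * real n)"
      by (rule tail_bound_bounded_iid[OF M _ bd C n]) (use e in auto)
    also have "P.prob ?H \<le> (\<integral>x. (\<Sum>i<n. h (x i)) \<partial>iid M n) / (real n * e)"
    proof (rule integral_Markov_inequality_measure[where A="{}"])
      show "integrable (iid M n) (\<lambda>x. \<Sum>i<n. h (x i))"
        by (intro Bochner_Integration.integrable_sum integrable_iid_component M inth) auto
      show "AE x in iid M n. 0 \<le> (\<Sum>i<n. h (x i))" by (auto intro!: sum_nonneg simp: h_def)
    qed (use n e in auto)
    also have "(\<integral>x. (\<Sum>i<n. h (x i)) \<partial>iid M n) = real n * (\<integral>x. h x \<partial>M)"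
      using integrable_iid_component[OF M inth, of _ n] by (simp add: Bochner_Integration.integral_sum)
    also have "real n * (\<integral>x. h x \<partial>M) / (real n * e) \<le> d / 2"
      using Eh n e by (simp add: field_simps)
    finally show ?thesis by simp
  qed
  have "(\<lambda>n. exp (- (e\<^sup>2 / (2 * C\<^sup>2)) * real n)) \<longlonglongrightarrow> 0"
  proof -
    have "(\<lambda>n. exp (- (e\<^sup>2 / (2 * C\<^sup>2))) ^ n) \<longlonglongrightarrow> 0"
      by (rule LIMSEQ_realpow_zero) (use e C in auto)
    then show ?thesis by (simp only: exp_of_nat2_mult)
  qed
  then have "eventually (\<lambda>n. exp (- (e\<^sup>2 / (2 * C\<^sup>2)) * real n) < d / 2) sequentially"
    by (rule order_tendstoD) (use d in simp)
  then have "eventually (\<lambda>n. measure (iid M n) {x\<in>space (iid M n). (\<Sum>i<n. g (x i)) \<ge> real n * t} < d) sequentially"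
    using eventually_gt_at_top[of 0]
  proof eventually_elim
    case (elim n)
    show ?case using key[OF elim(2)] elim(1) by linarith
  qed
  then show "\<exists>no. \<forall>n\<ge>no. norm (measure (iid M n) {x\<in>space (iid M n). (\<Sum>i<n. g (x i)) \<ge> real n * t} - 0) < d"
    unfolding eventually_sequentially by simp
qed

lemma weak_law_lower:
  fixes g :: "'x \<Rightarrow> real"
  assumes M: "prob_space M" and g: "integrable M g" and t: "t < (\<integral>x. g x \<partial>M)"
  shows "(\<lambda>n. measure (iid M n) {x\<in>space (iid M n). (\<Sum>i<n. g (x i)) \<le> real n * t}) \<longlonglongrightarrow> 0"
  using weak_law_upper[of M "\<lambda>x. - g x" "-t"] assms by (simp add: sum_negf)

section \<open>Hypothesis testing: Stein and Chernoff exponents\<close>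

lemma density_RN_deriv_real:
  assumes P: "prob_space P" and N: "prob_space N"
    and ac: "absolutely_continuous P N" and sets: "sets N = sets P"
  shows "N = density P (\<lambda>x. enn2real (RN_deriv P N x))"
proof -
  interpret P: prob_space P by fact
  interpret N: prob_space N by fact
  have fin: "AE x in P. RN_deriv P N x \<noteq> \<infinity>"
    by (rule P.RN_deriv_finite[OF N.sigma_finite_measure_axioms ac sets])
  have "N = density P (RN_deriv P N)" by (rule P.density_RN_deriv[OF ac sets, symmetric])
  also have "\<dots> = density P (\<lambda>x. ennreal (enn2real (RN_deriv P N x)))"
    by (rule density_cong) (use fin in \<open>auto simp: less_top\<close>)
  finally show ?thesis .
qed

text \<open>Any real version of the density may be used: it agrees with the Radon-Nikodym derivative
  almost everywhere for \<open>P\<close>, hence for \<open>N\<close>.\<close>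

lemma KL_density:
  fixes f :: "'x \<Rightarrow> real"
  assumes P: "prob_space P" and [measurable]: "f \<in> borel_measurable P" and f0: "\<And>x. f x \<ge> 0"
    and N: "N = density P f"
  shows "KL N P = (if integrable N (\<lambda>x. ln (f x)) then ereal (\<integral>x. ln (f x) \<partial>N) else \<infinity>)"
proof -
  interpret P: prob_space P by fact
  have ac: "absolutely_continuous P N" unfolding N by (rule absolutely_continuousI_density) simp
  have "AE x in P. ennreal (f x) = RN_deriv P N x"
    by (rule P.RN_deriv_unique) (simp_all add: N)
  then have "AE x in P. f x = enn2real (RN_deriv P N x)"
    by (rule eventually_mono) (metis f0 enn2real_ennreal)
  then have AE: "AE x in N. ln (enn2real (RN_deriv P N x)) = ln (f x)"
    by (intro absolutely_continuous_AE[OF _ ac]) (auto simp: N elim: eventually_mono)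
  have [measurable]: "RN_deriv P N \<in> borel_measurable N" "f \<in> borel_measurable N" unfolding N by simp_all
  have "integrable N (\<lambda>x. ln (enn2real (RN_deriv P N x))) \<longleftrightarrow> integrable N (\<lambda>x. ln (f x))"
    by (rule integrable_cong_AE[OF _ _ AE]) measurable
  moreover have "(\<integral>x. ln (enn2real (RN_deriv P N x)) \<partial>N) = (\<integral>x. ln (f x) \<partial>N)"
    by (rule integral_cong_AE[OF _ _ AE]) measurable
  moreover have "sets N = sets P" by (simp add: N)
  ultimately show ?thesis unfolding KL_def using ac by simp
qed

lemma KL_finite_density:
  assumes P: "prob_space P" and N: "prob_space N" and fin: "KL N P < ereal t"
  obtains r :: "'x \<Rightarrow> real" where "r \<in> borel_measurable P" "\<And>x. r x \<ge> 0" "N = density P r"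
    "integrable N (\<lambda>x. ln (r x))" "(\<integral>x. ln (r x) \<partial>N) < t"
proof (rule that[of "\<lambda>x. enn2real (RN_deriv P N x)"])
  have ac: "absolutely_continuous P N" "sets N = sets P"
    using fin by (auto simp: KL_def split: if_splits)
  show "N = density P (\<lambda>x. enn2real (RN_deriv P N x))"
    by (rule density_RN_deriv_real) fact+
  show "integrable N (\<lambda>x. ln (enn2real (RN_deriv P N x)))" "(\<integral>x. ln (enn2real (RN_deriv P N x)) \<partial>N) < t"
    using fin by (auto simp: KL_def split: if_splits)
qed auto

lemma sets_iid_density: "Q = density P f \<Longrightarrow> sets (iid Q n) = sets (iid P n)"
  by (intro sets_PiM_cong) auto

lemma space_iid_density: "Q = density P f \<Longrightarrow> space (iid Q n) = space (iid P n)"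
  by (rule sets_eq_imp_space_eq) (rule sets_iid_density)

lemma change_of_measure_iid:
  fixes r :: "'x \<Rightarrow> real"
  assumes P: "prob_space P" and Q: "prob_space Q"
    and [measurable]: "r \<in> borel_measurable P" and r0: "\<And>x. r x \<ge> 0" and Qd: "Q = density P r"
    and B: "B \<in> sets (iid P n)" and K: "K \<ge> 0" "\<And>x. x \<in> B \<Longrightarrow> (\<Prod>i<n. r (x i)) \<le> K"
  shows "measure (iid Q n) B \<le> K * measure (iid P n) B"
proof -
  interpret PP: prob_space "iid P n" by (rule prob_space_iid) fact
  interpret QQ: prob_space "iid Q n" by (rule prob_space_iid) fact
  have "emeasure (iid Q n) B = (\<integral>\<^sup>+x. ennreal (\<Prod>i<n. r (x i)) * indicator B x \<partial>iid P n)"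
    unfolding iid_density[OF P Q assms(3) r0 Qd] using B by (intro emeasure_density) auto
  also have "\<dots> \<le> (\<integral>\<^sup>+x. ennreal K * indicator B x \<partial>iid P n)"
    by (intro nn_integral_mono) (auto simp: indicator_def intro!: ennreal_leI K)
  also have "\<dots> = ennreal K * emeasure (iid P n) B"
    using B by (simp add: nn_integral_cmult_indicator)
  finally show ?thesis
    using K by (simp add: PP.emeasure_eq_measure QQ.emeasure_eq_measure flip: ennreal_mult)
qed

text \<open>Only an inequality, because a zero factor has \<open>ln 0 = 0\<close> and so contributes
  the factor 1 on the right.\<close>

lemma prod_le_exp_sum_ln:
  fixes r :: "'i \<Rightarrow> real"
  assumes "finite I" "\<And>i. i \<in> I \<Longrightarrow> r i \<ge> 0"
  shows "(\<Prod>i\<in>I. r i) \<le> exp (\<Sum>i\<in>I. ln (r i))"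
  unfolding exp_sum[OF assms(1)]
proof (rule prod_mono)
  show "0 \<le> r i \<and> r i \<le> exp (ln (r i))" if "i \<in> I" for i
    using assms(2)[OF that] by (cases "r i = 0") auto
qed

text \<open>By the weak law, outside a set of vanishing \<open>N\<close>-probability the density of
  \<open>N\<close> against \<open>P\<close> is at most \<open>exp (t * n)\<close>. An event of
  \<open>N\<close>-probability \<open>d\<close> keeps at least \<open>d / 2\<close> after that set
  is removed. The removed set does not depend on \<open>B\<close>, so the bound is uniform in
  \<open>B\<close>; this matters because \<open>B\<close> will come from an arbitrary
  contract.\<close>

lemma stein_lower:
  assumes P: "prob_space P" and N: "prob_space N" and t: "KL N P < ereal t" and d: "d > 0"
  shows "\<forall>\<^sub>F n in sequentially. \<forall>B\<in>sets (iid P n). d \<le> measure (iid N n) B \<longrightarrow>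
    d / 2 * exp (- t * real n) \<le> measure (iid P n) B"
proof -
  obtain r :: "'a \<Rightarrow> real" where r: "r \<in> borel_measurable P" "\<And>x. r x \<ge> 0" "N = density P r"
    "integrable N (\<lambda>x. ln (r x))" "(\<integral>x. ln (r x) \<partial>N) < t"
    using KL_finite_density[OF P N t] by blast
  note [measurable] = r(1)
  have [measurable]: "r \<in> borel_measurable N" unfolding r(3) by simp
  have "(\<lambda>n. measure (iid N n) {x\<in>space (iid N n). (\<Sum>i<n. ln (r (x i))) \<ge> real n * t}) \<longlonglongrightarrow> 0"
    by (rule weak_law_upper[OF N r(4,5)])
  then have "\<forall>\<^sub>F n in sequentially. measure (iid N n) {x\<in>space (iid N n). (\<Sum>i<n. ln (r (x i))) \<ge> real n * t} < d / 2"
    by (rule order_tendstoD) (use d in simp)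
  then show ?thesis
  proof eventually_elim
    case (elim n)
    interpret NN: prob_space "iid N n" by (rule prob_space_iid) fact
    interpret PP: prob_space "iid P n" by (rule prob_space_iid) fact
    show ?case
    proof (intro ballI impI)
      fix B assume B: "B \<in> sets (iid P n)" "d \<le> measure (iid N n) B"
      have BN: "B \<in> sets (iid N n)" using B(1) sets_iid_density[OF r(3)] by simp
      define H where "H = {x\<in>space (iid N n). (\<Sum>i<n. ln (r (x i))) \<ge> real n * t}"
      have H: "H \<in> sets (iid N n)" unfolding H_def by measurable
      have BH: "B - H \<in> sets (iid P n)" using BN H sets_iid_density[OF r(3), of n] by auto
      have "measure (iid N n) B \<le> measure (iid N n) (B - H) + measure (iid N n) H"
        using BN H by (intro order.trans[OF NN.finite_measure_mono measure_Un_le]) auto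
      then have "d / 2 \<le> measure (iid N n) (B - H)" using elim B(2) by (simp add: H_def)
      also have "\<dots> \<le> exp (t * real n) * measure (iid P n) (B - H)"
      proof (rule change_of_measure_iid[OF P N r(1-3) BH])
        fix x assume x: "x \<in> B - H"
        then have "x \<in> space (iid N n)" using BN sets.sets_into_space by auto
        then have "(\<Sum>i<n. ln (r (x i))) \<le> t * real n" using x by (auto simp: H_def mult.commute)
        then show "(\<Prod>i<n. r (x i)) \<le> exp (t * real n)"
          using prod_le_exp_sum_ln[of "{..<n}" "\<lambda>i. r (x i)"] r(2) by (auto intro: order.trans)
      qed simp
      also have "\<dots> \<le> exp (t * real n) * measure (iid P n) B"
        using B(1) by (intro mult_left_mono PP.finite_measure_mono) auto
      finally show "d / 2 * exp (- t * real n) \<le> measure (iid P n) B"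
        by (simp add: exp_minus field_simps)
    qed
  qed
qed

text \<open>Whichever of the two events is likely under the intermediate measure \<open>N\<close> keeps an
  exponentially large probability under the corresponding hypothesis.\<close>
lemma chernoff_lower:
  assumes P: "prob_space P" and Q: "prob_space Q" and N: "prob_space N"
    and sets: "sets P = sets N" "sets Q = sets N"
    and t: "KL N P < ereal t" "KL N Q < ereal t"
  shows "\<forall>\<^sub>F n in sequentially. \<forall>B\<in>sets (iid P n).
    exp (- t * real n) / 4 \<le> measure (iid P n) B + measure (iid Q n) (space (iid P n) - B)"
proof -
  \<comment> \<open>One of \<open>B\<close> and its complement reaches the level 1/2 under
    \<open>N\<close>; half of that level is the 1/4 in the conclusion.\<close>
  have h: "(0::real) < 1/2" by simp
  show ?thesis
    using stein_lower[OF P N t(1) h] stein_lower[OF Q N t(2) h]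
  proof eventually_elim
    case (elim n)
    interpret NN: prob_space "iid N n" by (rule prob_space_iid) fact
    have se: "sets (iid P n) = sets (iid N n)" "sets (iid Q n) = sets (iid N n)"
      by (intro sets_PiM_cong; use sets in simp)+
    have sp: "space (iid P n) = space (iid N n)" by (rule sets_eq_imp_space_eq) (rule se)
    show ?case
    proof
      fix B assume B: "B \<in> sets (iid P n)"
      have "measure (iid N n) (space (iid P n) - B) = 1 - measure (iid N n) B"
        unfolding sp using B se by (intro NN.prob_compl) auto
      then have "1/2 \<le> measure (iid N n) B \<or> 1/2 \<le> measure (iid N n) (space (iid P n) - B)" by linarith
      then have "exp (- t * real n) / 4 \<le> measure (iid P n) B
          \<or> exp (- t * real n) / 4 \<le> measure (iid Q n) (space (iid P n) - B)"
        using elim[THEN bspec, of B] elim(2)[THEN bspec, of "space (iid P n) - B"] B se sp by auto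
      then show "exp (- t * real n) / 4 \<le> measure (iid P n) B + measure (iid Q n) (space (iid P n) - B)"
        by (metis (no_types) add_increasing add_increasing2 measure_nonneg)
    qed
  qed
qed

text \<open>The error under \<open>P\<close> is bounded by Markov's inequality, since the likelihood
  ratio has \<open>P\<close>-mean 1; the error under \<open>Q\<close> vanishes by the weak law for
  its logarithm.\<close>

lemma stein_test:
  fixes r :: "'x \<Rightarrow> real"
  assumes P: "prob_space P" and Q: "prob_space Q"
    and [measurable]: "r \<in> borel_measurable P" and r0: "\<And>x. r x \<ge> 0" and Qd: "Q = density P r"
    and int: "integrable Q (\<lambda>x. ln (r x))" and t: "t < (\<integral>x. ln (r x) \<partial>Q)"
  defines "B \<equiv> \<lambda>n. {x\<in>space (iid P n). (\<Prod>i<n. r (x i)) < exp (t * real n)}"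
  shows "measure (iid P n) (space (iid P n) - B n) \<le> exp (- t * real n)"
    and "(\<lambda>n. measure (iid Q n) (B n)) \<longlonglongrightarrow> 0"
proof -
  interpret P: prob_space P by fact
  interpret Q: prob_space Q by fact
  interpret PS: product_sigma_finite "\<lambda>_::nat. P" by standard
  have [measurable]: "r \<in> borel_measurable Q" unfolding Qd by simp
  have intr: "integrable P r" "(\<integral>x. r x \<partial>P) = 1"
  proof -
    have "(\<integral>\<^sup>+x. ennreal (r x) \<partial>P) = emeasure Q (space Q)"
      unfolding Qd by (subst emeasure_density) (auto intro!: nn_integral_cong)
    then have "(\<integral>\<^sup>+x. ennreal (r x) \<partial>P) = ennreal 1" using Q.emeasure_space_1 by simp
    then show "integrable P r" "(\<integral>x. r x \<partial>P) = 1"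
      using r0 nn_integral_eq_integrable[of r P 1] by simp_all
  qed
  interpret PP: prob_space "iid P n" by (rule prob_space_iid) fact
  have eq: "space (iid P n) - B n = {x\<in>space (iid P n). (\<Prod>i<n. r (x i)) \<ge> exp (t * real n)}"
    by (auto simp: B_def)
  have "measure (iid P n) \<dots> \<le> (\<integral>x. (\<Prod>i<n. r (x i)) \<partial>iid P n) / exp (t * real n)"
  proof (rule integral_Markov_inequality_measure[where A="{}"])
    show "integrable (iid P n) (\<lambda>x. \<Prod>i<n. r (x i))"
      by (rule PS.product_integrable_prod) (auto simp: intr)
  qed (auto intro!: prod_nonneg r0)
  also have "(\<integral>x. (\<Prod>i<n. r (x i)) \<partial>iid P n) = 1"
    by (subst PS.product_integral_prod) (auto simp: intr)
  finally show "measure (iid P n) (space (iid P n) - B n) \<le> exp (- t * real n)"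
    unfolding eq by (simp add: exp_minus inverse_eq_divide)
  \<comment> \<open>The test compares the product of the ratios, the weak law the sum of their
    logarithms. The two agree only for positive ratios, which holds almost surely under
    \<open>Q\<close> because \<open>Q\<close> has density \<open>r\<close>.\<close>
  have pos: "AE x in Q. r x > 0"
    unfolding Qd by (subst AE_density) (auto simp: r0)
  show "(\<lambda>n. measure (iid Q n) (B n)) \<longlonglongrightarrow> 0"
  proof (rule tendsto_sandwich[OF _ _ tendsto_const weak_law_lower[OF Q int t]])
    show "\<forall>\<^sub>F n in sequentially. measure (iid Q n) (B n) \<le>
      measure (iid Q n) {x \<in> space (iid Q n). (\<Sum>i<n. ln (r (x i))) \<le> real n * t}"
    proof (rule always_eventually, rule allI)
      fix n
      interpret QQ: prob_space "iid Q n" by (rule prob_space_iid) fact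
      have "AE x in iid Q n. \<forall>i\<in>{..<n}. r (x i) > 0"
      proof (rule AE_finite_allI)
        show "AE x in iid Q n. r (x i) > 0" if "i \<in> {..<n}" for i
          by (rule AE_PiM_component[OF Q that pos])
      qed simp
      then have AE: "AE x in iid Q n. x \<in> B n \<longrightarrow> x \<in> {x \<in> space (iid Q n). (\<Sum>i<n. ln (r (x i))) \<le> real n * t}"
      proof eventually_elim
        fix x assume p: "\<forall>i\<in>{..<n}. r (x i) > 0"
        have pp: "(\<Prod>i<n. r (x i)) > 0" using p by (intro prod_pos) auto
        have s: "(\<Sum>i<n. ln (r (x i))) = ln (\<Prod>i<n. r (x i))" using p by (intro ln_prod[symmetric]) (fastforce simp: less_imp_neq[symmetric])+
        have "ln (\<Prod>i<n. r (x i)) < t * real n" if "(\<Prod>i<n. r (x i)) < exp (t * real n)"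
        proof -
          have "exp (ln (\<Prod>i<n. r (x i))) < exp (t * real n)" using that pp by simp
          then show ?thesis by (simp only: exp_less_cancel_iff)
        qed
        then show "x \<in> B n \<longrightarrow> x \<in> {x \<in> space (iid Q n). (\<Sum>i<n. ln (r (x i))) \<le> real n * t}"
          by (auto simp: s B_def space_iid_density[OF Qd] mult.commute)
      qed
      show "measure (iid Q n) (B n) \<le>
        measure (iid Q n) {x \<in> space (iid Q n). (\<Sum>i<n. ln (r (x i))) \<le> real n * t}"
        by (rule QQ.finite_measure_mono_AE[OF AE]) measurable
    qed
  qed auto
qed

section \<open>Moment generating function of the log-likelihood ratio, and exponential
  tilting\<close>

lemma abs_exp_minus_1_le: "\<bar>exp z - 1\<bar> \<le> \<bar>z\<bar> * exp \<bar>z\<bar>" for z :: real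
proof (cases "z \<ge> 0")
  case True
  have "(1 - z) * exp z \<le> exp (-z) * exp z"
    using exp_ge_add_one_self[of "-z"] by (intro mult_right_mono) auto
  also have "\<dots> = 1" by (simp flip: exp_add)
  finally show ?thesis using True by (simp add: algebra_simps)
next
  case False
  have "1 - exp z \<le> -z * 1" using exp_ge_add_one_self[of z] by linarith
  also have "\<dots> \<le> -z * exp (-z)" using False by (intro mult_left_mono) auto
  finally show ?thesis using False by simp
qed

text \<open>\<open>P\<close> will be the law of a signal under \<open>as\<close>, and
  \<open>Q\<close> the law under a cheaper action. A version of the density that is positive
  everywhere allows logarithms and real powers of \<open>r\<close> to be treated pointwise.\<close>

locale likelihood_ratio = P: prob_space P + Q: prob_space Q
  for P Q :: "'x measure" +
  fixes r :: "'x \<Rightarrow> real"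
  assumes r_meas [measurable]: "r \<in> borel_measurable P"
    and r_pos: "\<And>x. r x > 0"
    and Q_density: "Q = density P r"
    and r_moments: "\<And>l. l > 0 \<Longrightarrow> integrable P (\<lambda>x. r x powr l)"
begin

text \<open>This is the moment generating function of \<open>ln r\<close> under \<open>P\<close>,
  also known as the Hellinger integral of order \<open>s\<close>.\<close>

definition mgf :: "real \<Rightarrow> real" where "mgf s = (\<integral>x. r x powr s \<partial>P)"

lemma r_nonneg: "r x \<ge> 0"
  using r_pos[of x] by simp

lemma integrable_r_powr: "l \<ge> 0 \<Longrightarrow> integrable P (\<lambda>x. r x powr l)"
  using r_moments[of l] r_pos by (cases "l = 0") (auto simp: less_imp_neq[symmetric])

lemma measurable_Q [measurable]: "r \<in> borel_measurable Q"
  unfolding Q_density by simp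

lemma integral_Q:
  fixes f :: "'x \<Rightarrow> real"
  assumes [measurable]: "f \<in> borel_measurable P"
  shows "(\<integral>x. f x \<partial>Q) = (\<integral>x. r x * f x \<partial>P)"
    and "integrable Q f \<longleftrightarrow> integrable P (\<lambda>x. r x * f x)"
  unfolding Q_density
  by (simp_all add: integral_density integrable_density r_nonneg)

lemma mgf_0: "mgf 0 = 1"
  unfolding mgf_def using r_pos by (simp add: less_imp_neq[symmetric] P.prob_space)

lemma mgf_1: "mgf 1 = 1"
proof -
  have "(\<integral>x. 1 \<partial>Q) = (\<integral>x. r x * 1 \<partial>P)" by (rule integral_Q) simp
  then show ?thesis unfolding mgf_def using r_nonneg by (simp add: Q.prob_space)
qed

lemma mgf_pos:
  assumes "s \<ge> 0" shows "mgf s > 0"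
proof -
  have "mgf s \<noteq> 0"
  proof
    assume "mgf s = 0"
    then have "AE x in P. r x powr s = 0"
      unfolding mgf_def by (subst (asm) integral_nonneg_eq_0_iff_AE) (use assms integrable_r_powr in auto)
    then have "AE x in P. False" by eventually_elim (use r_pos in \<open>auto simp: less_imp_neq[symmetric]\<close>)
    then show False by simp
  qed
  moreover have "mgf s \<ge> 0" unfolding mgf_def by simp
  ultimately show ?thesis by simp
qed

text \<open>The squared Hellinger distance, the \<open>P\<close>-mean of
  \<open>(1 - sqrt r)^2\<close>, equals \<open>2 - 2 * mgf (1/2)\<close> and vanishes only if
  \<open>r = 1\<close> almost everywhere.\<close>

lemma mgf_half:
  assumes "P \<noteq> Q" shows "mgf (1/2) < 1"
proof (rule ccontr)
  assume a: "\<not> mgf (1/2) < 1"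
  have sq: "(1 - r x powr (1/2))\<^sup>2 = 1 - 2 * r x powr (1/2) + r x powr 1" for x
    using r_nonneg[of x] by (simp add: power2_diff powr_half_sqrt)
  have i: "integrable P (\<lambda>x. (1 - r x powr (1/2))\<^sup>2)"
    unfolding sq by (intro Bochner_Integration.integrable_add Bochner_Integration.integrable_diff integrable_mult_right integrable_r_powr) auto
  have "(\<integral>x. (1 - r x powr (1/2))\<^sup>2 \<partial>P) = 1 - 2 * mgf (1/2) + mgf 1"
    unfolding sq mgf_def using integrable_r_powr[of "1/2"] integrable_r_powr[of 1]
    by (simp add: P.prob_space del: powr_one)
  then have "(\<integral>x. (1 - r x powr (1/2))\<^sup>2 \<partial>P) \<le> 0" using a mgf_1 by simp
  moreover have "(\<integral>x. (1 - r x powr (1/2))\<^sup>2 \<partial>P) \<ge> 0" by simp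
  ultimately have "(\<integral>x. (1 - r x powr (1/2))\<^sup>2 \<partial>P) = 0" by linarith
  then have "AE x in P. (1 - r x powr (1/2))\<^sup>2 = 0"
    by (subst (asm) integral_nonneg_eq_0_iff_AE[OF i]) auto
  then have "AE x in P. ennreal (r x) = 1"
    by eventually_elim (use r_nonneg in \<open>auto simp: powr_half_sqrt\<close>)
  then have "density P r = density P (\<lambda>_. 1)" by (intro density_cong) auto
  then show False using assms Q_density by (simp add: density_1)
qed

text \<open>For exponents in [0,1] all powers of \<open>r\<close> are dominated by
  \<open>1 + r\<close>.\<close>

lemma continuous_on_mgf: "continuous_on {0..1} mgf"
proof (unfold continuous_on_sequentially, intro ballI allI impI)
  fix t a assume a: "a \<in> {0..1}" and t: "(\<forall>n. t n \<in> {0..1}) \<and> t \<longlonglongrightarrow> (a::real)"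
  show "(mgf \<circ> t) \<longlonglongrightarrow> mgf a"
    unfolding mgf_def comp_def
  proof (rule integral_dominated_convergence[where w="\<lambda>x. 1 + r x powr 1"])
    show "integrable P (\<lambda>x. 1 + r x powr 1)"
      by (intro Bochner_Integration.integrable_add integrable_r_powr) auto
    show "AE x in P. (\<lambda>n. r x powr t n) \<longlonglongrightarrow> r x powr a"
      by (intro AE_I2 tendsto_powr tendsto_const) (use t r_pos in \<open>auto simp: less_imp_neq[symmetric]\<close>)
    show "AE x in P. norm (r x powr t n) \<le> 1 + r x powr 1" for n
    proof (rule AE_I2)
      fix x
      have "t n \<ge> 0" "t n \<le> 1" using t by auto
      then show "norm (r x powr t n) \<le> 1 + r x powr 1"
        using powr_le1[of "t n" "r x"] powr_mono[of "t n" 1 "r x"] r_pos[of x]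
        by (cases "r x \<le> 1") (auto simp: r_nonneg)
    qed
  qed auto
qed

text \<open>\<open>mgf\<close> is 1 at both endpoints and below 1 at 1/2. An interior minimizer is
  wanted for the first-order condition.\<close>

lemma interior_minimizer:
  assumes "P \<noteq> Q"
  obtains s where "0 < s" "s < 1" "mgf s < 1" "\<And>s'. s' \<in> {0..1} \<Longrightarrow> mgf s \<le> mgf s'"
proof -
  obtain s where s: "s \<in> {0..1}" "\<And>s'. s' \<in> {0..1} \<Longrightarrow> mgf s \<le> mgf s'"
    using continuous_attains_inf[of "{0..1::real}" mgf] continuous_on_mgf by auto
  have lt: "mgf s < 1" using s(2)[of "1/2"] mgf_half[OF assms] by simp
  then have "s \<noteq> 0" "s \<noteq> 1" using mgf_0 mgf_1 by auto
  then show ?thesis using that[of s] s lt by auto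
qed

text \<open>A dominating function uniform in the step \<open>t\<close>. With
  \<open>y = ln r\<close>, the quotient of \<open>exp (t * y) - 1\<close> by \<open>t\<close> is at
  most \<open>|y| * exp (d * |y|)\<close>, and \<open>d * |y| <= exp (d * |y|)\<close> trades the
  factor \<open>|y|\<close> for a second exponential.\<close>

lemma powr_quotient_bound:
  assumes d: "d > 0" and t: "\<bar>t\<bar> \<le> d" "t \<noteq> 0"
  shows "\<bar>(r x powr (s + t) - r x powr s) / t\<bar> \<le> (r x powr (s + 2 * d) + r x powr (s - 2 * d)) / d"
proof -
  define y where "y = ln (r x)"
  have R: "r x powr a = exp (a * y)" for a using r_pos[of x] by (simp add: powr_def y_def)
  have "\<bar>(r x powr (s + t) - r x powr s) / t\<bar> = exp (s * y) * (\<bar>exp (t * y) - 1\<bar> / \<bar>t\<bar>)"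
    unfolding R by (simp add: distrib_right exp_add abs_mult flip: right_diff_distrib' [where c=1, simplified])
  also have "\<dots> \<le> exp (s * y) * ((exp (2 * d * y) + exp (- 2 * d * y)) / d)"
  proof (rule mult_left_mono)
    have "\<bar>exp (t * y) - 1\<bar> / \<bar>t\<bar> \<le> \<bar>t * y\<bar> * exp \<bar>t * y\<bar> / \<bar>t\<bar>"
      by (intro divide_right_mono abs_exp_minus_1_le) auto
    also have "\<dots> = \<bar>y\<bar> * exp (\<bar>t\<bar> * \<bar>y\<bar>)" using t by (simp add: abs_mult)
    also have "\<dots> \<le> (exp (d * \<bar>y\<bar>) / d) * exp (d * \<bar>y\<bar>)"
    proof (intro mult_mono)
      have "d * \<bar>y\<bar> \<le> exp (d * \<bar>y\<bar>)" using exp_ge_add_one_self[of "d * \<bar>y\<bar>"] by linarith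
      then show "\<bar>y\<bar> \<le> exp (d * \<bar>y\<bar>) / d" using d by (simp add: field_simps)
    qed (use t d in \<open>auto intro: mult_right_mono\<close>)
    also have "\<dots> = exp (2 * d * \<bar>y\<bar>) / d" by (simp flip: exp_add)
    also have "\<dots> \<le> (exp (2 * d * y) + exp (- 2 * d * y)) / d"
      using d by (intro divide_right_mono) (auto simp: abs_if)
    finally show "\<bar>exp (t * y) - 1\<bar> / \<bar>t\<bar> \<le> (exp (2 * d * y) + exp (- 2 * d * y)) / d" .
  qed simp
  also have "\<dots> = (r x powr (s + 2 * d) + r x powr (s - 2 * d)) / d"
    unfolding R by (simp add: algebra_simps flip: exp_add)
  finally show ?thesis .
qed

text \<open>The derivative in the exponent inherits the bound of the difference quotients by passing
  to the limit.\<close>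

lemma powr_ln_bound:
  assumes d: "d > 0"
  shows "\<bar>r x powr s * ln (r x)\<bar> \<le> (r x powr (s + 2 * d) + r x powr (s - 2 * d)) / d"
proof -
  have 1: "((\<lambda>s. r x powr s) has_real_derivative r x powr s * ln (r x)) (at s)"
    using r_pos[of x] by (auto intro!: derivative_eq_intros)
  have "(\<lambda>k. \<bar>(r x powr (s + d / real (Suc k)) - r x powr s) / (d / real (Suc k))\<bar>) \<longlonglongrightarrow> \<bar>r x powr s * ln (r x)\<bar>"
  proof (intro tendsto_rabs)
    have "filterlim (\<lambda>k. d / real (Suc k)) (at 0) sequentially"
      unfolding filterlim_at using d
      by (auto simp del: of_nat_Suc intro!: LIMSEQ_Suc[OF lim_const_over_n])
    from filterlim_compose[OF DERIV_D[OF 1] this]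
    show "(\<lambda>k. (r x powr (s + d / real (Suc k)) - r x powr s) / (d / real (Suc k))) \<longlonglongrightarrow> r x powr s * ln (r x)" .
  qed
  then show ?thesis
  proof (rule LIMSEQ_le_const2, intro exI[of _ 0] allI impI)
    fix k
    show "\<bar>(r x powr (s + d / real (Suc k)) - r x powr s) / (d / real (Suc k))\<bar>
      \<le> (r x powr (s + 2 * d) + r x powr (s - 2 * d)) / d"
      by (rule powr_quotient_bound[OF d]) (use d in \<open>auto simp: field_simps\<close>)
  qed
qed

lemma integrable_powr_ln:
  assumes "s > 0" shows "integrable P (\<lambda>x. r x powr s * ln (r x))"
proof (rule Bochner_Integration.integrable_bound)
  \<comment> \<open>With \<open>d = s / 4\<close> the exponents in the bound are
    \<open>3 * s / 2\<close> and \<open>s / 2\<close>, both positive, so the moment assumption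
    applies.\<close>
  show "integrable P (\<lambda>x. (r x powr (s + 2 * (s/4)) + r x powr (s - 2 * (s/4))) / (s/4))"
    using assms by (intro integrable_divide Bochner_Integration.integrable_add integrable_r_powr) auto
  show "AE x in P. norm (r x powr s * ln (r x)) \<le> norm ((r x powr (s + 2 * (s/4)) + r x powr (s - 2 * (s/4))) / (s/4))"
    using powr_ln_bound[of "s/4" _ s] assms by (auto intro!: AE_I2 order.trans[OF _ abs_ge_self] simp del: abs_divide)
qed measurable

lemma mgf_derivative_seq:
  assumes s: "s > 0" and t: "t \<longlonglongrightarrow> 0" "\<And>k. \<bar>t k\<bar> \<le> s / 4" "\<And>k. t k \<noteq> 0"
  shows "(\<lambda>k. (mgf (s + t k) - mgf s) / t k) \<longlonglongrightarrow> (\<integral>x. r x powr s * ln (r x) \<partial>P)"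
proof -
  have "(\<lambda>k. \<integral>x. (r x powr (s + t k) - r x powr s) / t k \<partial>P) \<longlonglongrightarrow> (\<integral>x. r x powr s * ln (r x) \<partial>P)"
  proof (rule integral_dominated_convergence)
    show "integrable P (\<lambda>x. (r x powr (s + 2 * (s/4)) + r x powr (s - 2 * (s/4))) / (s/4))"
      using s by (intro integrable_divide Bochner_Integration.integrable_add integrable_r_powr) auto
    show "AE x in P. norm ((r x powr (s + t k) - r x powr s) / t k) \<le> (r x powr (s + 2 * (s/4)) + r x powr (s - 2 * (s/4))) / (s/4)" for k
      unfolding real_norm_def by (intro AE_I2 powr_quotient_bound) (use s t in auto)
    show "AE x in P. (\<lambda>k. (r x powr (s + t k) - r x powr s) / t k) \<longlonglongrightarrow> r x powr s * ln (r x)"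
    proof (rule AE_I2)
      fix x
      have 1: "((\<lambda>s. r x powr s) has_real_derivative r x powr s * ln (r x)) (at s)"
        using r_pos[of x] by (auto intro!: derivative_eq_intros)
      have "filterlim t (at 0) sequentially" unfolding filterlim_at using t by auto
      from filterlim_compose[OF DERIV_D[OF 1] this]
      show "(\<lambda>k. (r x powr (s + t k) - r x powr s) / t k) \<longlonglongrightarrow> r x powr s * ln (r x)" .
    qed
  qed measurable
  moreover have "(\<integral>x. (r x powr (s + t k) - r x powr s) / t k \<partial>P) = (mgf (s + t k) - mgf s) / t k" for k
  proof -
    have "s + t k \<ge> 0" using t(2)[of k] s by linarith
    then show ?thesis unfolding mgf_def using integrable_r_powr s by simp
  qed
  ultimately show ?thesis by (simp only:)
qed

text \<open>The integral is the derivative of \<open>mgf\<close> at an interior minimum: quotients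
  from the right are nonnegative and those from the left nonpositive.\<close>

lemma integral_powr_ln_eq_0:
  assumes s: "0 < s" "s < 1" and min: "\<And>s'. s' \<in> {0..1} \<Longrightarrow> mgf s \<le> mgf s'"
  shows "(\<integral>x. r x powr s * ln (r x) \<partial>P) = 0"
proof (rule antisym)
  \<comment> \<open>Steps up to \<open>d\<close> stay inside [0,1] on both sides of \<open>s\<close>
    and within the range of the dominating function.\<close>
  define d where "d = min (s / 4) (1 - s)"
  have d: "d > 0" "d \<le> s / 4" "d \<le> 1 - s" using s by (auto simp: d_def min_def)
  define t where "t k = d / real (Suc k)" for k
  have t: "t \<longlonglongrightarrow> 0" unfolding t_def
    by (auto simp del: of_nat_Suc intro!: LIMSEQ_Suc[OF lim_const_over_n])
  have tk: "0 < t k" "t k \<le> d" for k using d by (auto simp: t_def field_simps)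
  have q: "\<bar>t k\<bar> \<le> s/4" "t k \<noteq> 0" for k using tk[of k] d by auto
  have "(\<lambda>k. (mgf (s + t k) - mgf s) / t k) \<longlonglongrightarrow> (\<integral>x. r x powr s * ln (r x) \<partial>P)"
    by (rule mgf_derivative_seq) (use s t q in auto)
  then show "0 \<le> (\<integral>x. r x powr s * ln (r x) \<partial>P)"
  proof (rule LIMSEQ_le_const, intro exI[of _ 0] allI impI)
    fix k show "0 \<le> (mgf (s + t k) - mgf s) / t k"
      using min[of "s + t k"] tk[of k] d s by auto
  qed
  have "(\<lambda>k. (mgf (s + - t k) - mgf s) / - t k) \<longlonglongrightarrow> (\<integral>x. r x powr s * ln (r x) \<partial>P)"
    by (rule mgf_derivative_seq) (use s tendsto_minus[OF t] q in auto)
  then show "(\<integral>x. r x powr s * ln (r x) \<partial>P) \<le> 0"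
  proof (rule LIMSEQ_le_const2, intro exI[of _ 0] allI impI)
    fix k show "(mgf (s + - t k) - mgf s) / - t k \<le> 0"
      using min[of "s + - t k"] tk[of k] d s by (auto intro!: divide_nonneg_nonpos simp: divide_le_0_iff)
  qed
qed

text \<open>At the minimizer \<open>s\<close> of the moment generating function the tilted measure with
  density proportional to \<open>r powr s\<close> is equidistant from \<open>P\<close> and \<open>Q\<close>.\<close>
lemma equidistant_measure:
  assumes s: "0 < s" "s < 1" and min: "\<And>s'. s' \<in> {0..1} \<Longrightarrow> mgf s \<le> mgf s'"
  obtains N where "prob_space N" "sets N = sets P"
    "KL N P = ereal (- ln (mgf s))" "KL N Q = ereal (- ln (mgf s))"
proof -
  define Z where "Z = mgf s"
  have Z: "Z > 0" unfolding Z_def by (rule mgf_pos) (use s in auto)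
  define f where "f x = r x powr s / Z" for x
  define N where "N = density P f"
  have [measurable]: "f \<in> borel_measurable P" unfolding f_def by simp
  have f0: "f x \<ge> 0" for x using Z by (simp add: f_def)
  have intf: "integrable P f" "(\<integral>x. f x \<partial>P) = 1"
    unfolding f_def using integrable_r_powr[of s] s Z by (auto simp: Z_def mgf_def)
  have N: "prob_space N"
  proof
    have "emeasure N (space N) = (\<integral>\<^sup>+x. ennreal (f x) \<partial>P)"
      unfolding N_def by (subst emeasure_density) (auto intro!: nn_integral_cong)
    also have "\<dots> = 1" using nn_integral_eq_integral[OF intf(1)] f0 intf(2) by simp
    finally show "emeasure N (space N) = 1" .
  qed
  \<comment> \<open>Both log-densities of \<open>N\<close> have the form
    \<open>a * ln r - ln Z\<close>, with \<open>a = s\<close> against \<open>P\<close> and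
    \<open>a = s - 1\<close> against \<open>Q\<close>. By the first-order condition
    \<open>ln r\<close> has \<open>N\<close>-mean 0, so the value does not depend on
    \<open>a\<close>.\<close>
  have iN: "(\<integral>x. a * ln (r x) - ln Z \<partial>N) = - ln Z" "integrable N (\<lambda>x. a * ln (r x) - ln Z)" for a
  proof -
    have eq: "f x * (a * ln (r x) - ln Z) = (a / Z) * (r x powr s * ln (r x)) - ln Z * f x" for x
      using Z by (simp add: f_def field_simps)
    show "integrable N (\<lambda>x. a * ln (r x) - ln Z)"
      unfolding N_def using integrable_powr_ln[of s] s intf
      by (simp add: integrable_density f0 eq)
    show "(\<integral>x. a * ln (r x) - ln Z \<partial>N) = - ln Z"
      unfolding N_def using integrable_powr_ln[of s] s intf integral_powr_ln_eq_0[OF s min]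
      by (simp add: integral_density f0 eq)
  qed
  have l1: "ln (f x) = s * ln (r x) - ln Z" for x
    using r_pos[of x] Z by (simp add: f_def ln_div ln_powr)
  have K1: "KL N P = ereal (- ln Z)"
    by (subst KL_density[OF P.prob_space_axioms _ f0 N_def]) (simp_all add: l1 iN)
  define g where "g x = r x powr (s - 1) / Z" for x
  have g0: "g x \<ge> 0" for x using Z by (simp add: g_def)
  have [measurable]: "g \<in> borel_measurable P" "g \<in> borel_measurable Q" unfolding g_def by simp_all
  have N2: "N = density Q g"
  proof -
    have "r x * g x = f x" for x
      using powr_add[of "r x" 1 "s - 1"] r_nonneg[of x] by (simp add: f_def g_def)
    then show ?thesis unfolding N_def Q_density
      by (subst density_density_eq) (simp_all add: r_nonneg flip: ennreal_mult')
  qed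
  have l2: "ln (g x) = (s - 1) * ln (r x) - ln Z" for x
    using r_pos[of x] Z by (simp add: g_def ln_div ln_powr)
  have K2: "KL N Q = ereal (- ln Z)"
    by (subst KL_density[OF Q.prob_space_axioms _ g0 N2]) (simp_all add: l2 iN)
  show ?thesis
    by (rule that[OF N]) (simp_all add: N_def[symmetric] K1 K2 flip: Z_def, simp add: N_def)
qed

text \<open>With \<open>L\<close> the likelihood ratio of the sample, both errors are dominated by
  the \<open>P\<close>-mean of \<open>L powr s\<close>: on \<open>L >= 1\<close> this power is at
  least 1, and on \<open>L < 1\<close> it is at least \<open>L\<close> because
  \<open>s < 1\<close>.\<close>

lemma chernoff_test:
  assumes s: "0 < s" "s < 1"
  defines "B \<equiv> \<lambda>n. {x\<in>space (iid P n). (\<Prod>i<n. r (x i)) < 1}"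
  shows "measure (iid P n) (space (iid P n) - B n) \<le> mgf s ^ n"
    and "measure (iid Q n) (B n) \<le> mgf s ^ n"
proof -
  interpret PS: product_sigma_finite "\<lambda>_::nat. P" by standard
  interpret PP: prob_space "iid P n" by (rule prob_space_iid) (rule P.prob_space_axioms)
  interpret QQ: prob_space "iid Q n" by (rule prob_space_iid) (rule Q.prob_space_axioms)
  have [measurable]: "B n \<in> sets (iid P n)" unfolding B_def by measurable
  let ?L = "\<lambda>x. \<Prod>i<n. r (x i)"
  let ?S = "\<lambda>x. \<Prod>i<n. r (x i) powr s"
  have LS: "?S x = ?L x powr s" "?L x \<ge> 0" for x
    by (simp_all add: prod_powr_distrib r_nonneg prod_nonneg)
  have i: "integrable (iid P n) ?S"
    by (rule PS.product_integrable_prod) (use integrable_r_powr s in auto)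
  have e: "(\<integral>x. ?S x \<partial>iid P n) = mgf s ^ n"
    by (subst PS.product_integral_prod) (use integrable_r_powr s in \<open>auto simp: mgf_def\<close>)
  have "measure (iid P n) (space (iid P n) - B n) \<le> measure (iid P n) {x\<in>space (iid P n). ?S x \<ge> 1}"
    by (intro PP.finite_measure_mono) (use s in \<open>auto simp: B_def LS not_less ge_one_powr_ge_zero\<close>)
  also have "\<dots> \<le> (\<integral>x. ?S x \<partial>iid P n) / 1"
    by (rule integral_Markov_inequality_measure[OF i, where A="{}"]) (auto intro!: prod_nonneg)
  finally show "measure (iid P n) (space (iid P n) - B n) \<le> mgf s ^ n" using e by simp
  have "emeasure (iid Q n) (B n) = (\<integral>\<^sup>+x. ennreal (?L x) * indicator (B n) x \<partial>iid P n)"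
    unfolding iid_density[OF P.prob_space_axioms Q.prob_space_axioms r_meas r_nonneg Q_density]
    by (intro emeasure_density) auto
  also have "\<dots> \<le> (\<integral>\<^sup>+x. ennreal (?S x) \<partial>iid P n)"
  proof (rule nn_integral_mono)
    fix x
    have "?L x \<le> ?S x" if "?L x < 1"
      unfolding LS using powr_mono'[of s 1 "?L x"] that LS(2)[of x] s by simp
    then show "ennreal (?L x) * indicator (B n) x \<le> ennreal (?S x)"
      by (auto simp: B_def indicator_def intro!: ennreal_leI)
  qed
  also have "\<dots> = ennreal (mgf s ^ n)"
    by (subst nn_integral_eq_integral[OF i]) (auto intro!: prod_nonneg simp: e)
  finally show "measure (iid Q n) (B n) \<le> mgf s ^ n"
    using mgf_pos[of s] s by (simp add: QQ.emeasure_eq_measure)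
qed

lemma KL_eq: "KL Q P = ereal (\<integral>x. ln (r x) \<partial>Q)" and integrable_ln: "integrable Q (\<lambda>x. ln (r x))"
proof -
  show i: "integrable Q (\<lambda>x. ln (r x))"
    using integrable_powr_ln[of 1] by (simp add: integral_Q(2) r_nonneg)
  show "KL Q P = ereal (\<integral>x. ln (r x) \<partial>Q)"
    by (subst KL_density[OF P.prob_space_axioms r_meas r_nonneg Q_density]) (simp add: i)
qed

text \<open>Apply \<open>ln z <= z - 1\<close> to \<open>z = r powr -(1/2)\<close> and integrate,
  which gives at least \<open>2 - 2 * mgf (1/2)\<close>. With \<open>z = 1 / r\<close> the same
  bound would only give 0.\<close>

lemma KL_pos:
  assumes "P \<noteq> Q" shows "(\<integral>x. ln (r x) \<partial>Q) > 0"
proof -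
  have eq: "r x * r x powr - (1/2) = r x powr (1/2)" for x
    using powr_add[of "r x" 1 "-(1/2)"] r_nonneg[of x] by simp
  have i: "integrable Q (\<lambda>x. r x powr - (1/2))" and e: "(\<integral>x. r x powr - (1/2) \<partial>Q) = mgf (1/2)"
    using integrable_r_powr[of "1/2"] by (simp_all add: integral_Q eq mgf_def)
  have "(\<integral>x. 2 - 2 * r x powr - (1/2) \<partial>Q) \<le> (\<integral>x. ln (r x) \<partial>Q)"
  proof (rule integral_mono)
    fix x
    have "ln (r x powr - (1/2)) \<le> r x powr - (1/2) - 1"
      using r_pos[of x] by (intro ln_le_minus_one) simp
    then show "2 - 2 * r x powr - (1/2) \<le> ln (r x)" using r_pos[of x] by (simp add: ln_powr)
  qed (use i integrable_ln in auto)
  then show ?thesis using i e mgf_half[OF assms] by (simp add: Q.prob_space)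
qed

end

text \<open>The equidistant measure is a competitor in the infimum. This inequality suffices for the
  rate: the achievable exponent is never below the one that bounds the cost from below.\<close>

lemma Chernoff_le:
  fixes P Q :: "'x::euclidean_space measure"
  assumes L: "likelihood_ratio P Q r" and X: "sets P = sets (restrict_space borel X)"
    and s: "0 < s" "s < 1"
    and min: "\<And>s'. s' \<in> {0..1} \<Longrightarrow> likelihood_ratio.mgf P r s \<le> likelihood_ratio.mgf P r s'"
  shows "Chernoff X Q P \<le> ereal (- ln (likelihood_ratio.mgf P r s))"
proof -
  interpret likelihood_ratio P Q r by fact
  obtain N where N: "prob_space N" "sets N = sets P" "KL N P = ereal (- ln (mgf s))" "KL N Q = ereal (- ln (mgf s))"
    using equidistant_measure[OF s min] by blast
  then have "N \<in> prob_measures_on X" by (simp add: prob_measures_on_def X)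
  then show ?thesis unfolding Chernoff_def
    by (rule INF_lower2) (simp add: N)
qed

section \<open>Exponentially decaying errors and tests of prescribed rate\<close>

lemma exp_decay_tendsto_0: "a < 0 \<Longrightarrow> (\<lambda>n. exp (a * real n)) \<longlonglongrightarrow> 0" for a :: real
  unfolding exp_of_nat2_mult by (rule LIMSEQ_realpow_zero) auto

lemma exp_decay_scaled:
  fixes t s :: real
  assumes p: "\<And>n. 0 \<le> p n" "\<And>n. p n \<le> exp (- s * real n)" and s: "s > 0" "t < s"
  shows "p \<longlonglongrightarrow> 0" "(\<lambda>n. exp (t * real n) * p n) \<longlonglongrightarrow> 0"
proof -
  show "p \<longlonglongrightarrow> 0"
    by (rule tendsto_sandwich[OF _ _ tendsto_const exp_decay_tendsto_0[of "-s"]]) (use p s in auto)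
  show "(\<lambda>n. exp (t * real n) * p n) \<longlonglongrightarrow> 0"
  proof (rule tendsto_sandwich[OF _ _ tendsto_const exp_decay_tendsto_0[of "t - s"]])
    have "exp (t * real n) * p n \<le> exp ((t - s) * real n)" for n
      using mult_left_mono[OF p(2), of "exp (t * real n)" n] by (simp add: algebra_simps flip: exp_add)
    then show "\<forall>\<^sub>F n in sequentially. exp (t * real n) * p n \<le> exp ((t - s) * real n)" by simp
  qed (use p s in auto)
qed

lemma exp_decay_eventually:
  fixes t s :: real
  assumes "C > 0" "s < t"
  shows "\<forall>\<^sub>F n in sequentially. exp (- t * real n) \<le> C * exp (- s * real n)"
proof -
  have "\<forall>\<^sub>F n in sequentially. exp ((s - t) * real n) < C"
    by (rule order_tendstoD(2)[OF exp_decay_tendsto_0]) (use assms in auto)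
  then show ?thesis
  proof eventually_elim
    case (elim n)
    have "exp (- t * real n) = exp ((s - t) * real n) * exp (- s * real n)"
      by (simp add: algebra_simps flip: exp_add)
    also have "\<dots> \<le> C * exp (- s * real n)" using elim by (intro mult_right_mono) auto
    finally show ?case .
  qed
qed

text \<open>The third conjunct implies the second only if \<open>t \<ge> 0\<close>.\<close>
definition test_rate :: "'x measure \<Rightarrow> 'x measure \<Rightarrow> real \<Rightarrow> (nat \<Rightarrow> (nat \<Rightarrow> 'x) set) \<Rightarrow> bool" where
  "test_rate P Q t B \<longleftrightarrow> (\<forall>n. B n \<in> sets (iid P n))
     \<and> (\<lambda>n. measure (iid P n) (space (iid P n) - B n)) \<longlonglongrightarrow> 0
     \<and> (\<lambda>n. exp (t * real n) * measure (iid P n) (space (iid P n) - B n)) \<longlonglongrightarrow> 0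
     \<and> (\<lambda>n. measure (iid Q n) (B n)) \<longlonglongrightarrow> 0"

context likelihood_ratio
begin

lemma stein_test_rate:
  assumes ne: "P \<noteq> Q" and t: "t < (\<integral>x. ln (r x) \<partial>Q)"
  shows "\<exists>B. test_rate P Q t B"
proof -
  \<comment> \<open>The rate \<open>t\<close> may be negative, but the error under \<open>P\<close>
    must vanish by itself, so the threshold exponent is taken positive as well;
    \<open>KL_pos\<close> leaves room for it.\<close>
  obtain s where s: "max t 0 < s" "s < (\<integral>x. ln (r x) \<partial>Q)"
    using dense[of "max t 0" "\<integral>x. ln (r x) \<partial>Q"] KL_pos[OF ne] t by auto
  define B where "B n = {x\<in>space (iid P n). (\<Prod>i<n. r (x i)) < exp (s * real n)}" for n
  note test = stein_test[OF P.prob_space_axioms Q.prob_space_axioms r_meas r_nonneg Q_density integrable_ln s(2), folded B_def]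
  have "B n \<in> sets (iid P n)" for n unfolding B_def by measurable
  moreover note exp_decay_scaled[of "\<lambda>n. measure (iid P n) (space (iid P n) - B n)" s t, OF _ test(1)]
  ultimately show ?thesis unfolding test_rate_def using test(2) s by (intro exI[of _ B]) auto
qed

lemma chernoff_test_rate:
  assumes s: "0 < s" "s < 1" "mgf s < 1" and t: "t < - ln (mgf s)"
  shows "\<exists>B. test_rate P Q t B \<and> (\<lambda>n. exp (t * real n) * measure (iid Q n) (B n)) \<longlonglongrightarrow> 0"
proof -
  define k where "k = - ln (mgf s)"
  have mp: "mgf s > 0" using mgf_pos s by simp
  have k: "k > 0" "t < k" using mp s t by (auto simp: k_def)
  have e: "mgf s ^ n = exp (- k * real n)" for n
    unfolding exp_of_nat2_mult using mp by (simp add: k_def)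
  define B where "B n = {x\<in>space (iid P n). (\<Prod>i<n. r (x i)) < 1}" for n
  note test = chernoff_test[OF s(1,2), folded B_def, unfolded e]
  have "B n \<in> sets (iid P n)" for n unfolding B_def by measurable
  moreover note exp_decay_scaled[of "\<lambda>n. measure (iid P n) (space (iid P n) - B n)" k t, OF _ test(1) k]
  moreover note exp_decay_scaled[of "\<lambda>n. measure (iid Q n) (B n)" k t, OF _ test(2) k]
  ultimately show ?thesis unfolding test_rate_def by (intro exI[of _ B]) auto
qed

end

lemma likelihood_ratio_exists:
  assumes P: "prob_space P" and Q: "prob_space Q" and sets: "sets Q = sets P"
    and ac: "absolutely_continuous P Q" "absolutely_continuous Q P"
    and mom: "\<And>l. l > 0 \<Longrightarrow> integrable P (\<lambda>x. enn2real (RN_deriv P Q x) powr l)"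
  shows "\<exists>r. likelihood_ratio P Q r"
proof -
  define q where "q x = enn2real (RN_deriv P Q x)" for x
  \<comment> \<open>The set where \<open>q\<close> is 0 is null for \<open>Q\<close>, hence for
    \<open>P\<close> by mutual absolute continuity, so changing the value there to 1 keeps the
    density and makes it positive everywhere.\<close>
  define r where "r x = (if q x = 0 then 1 else q x)" for x
  have [measurable]: "q \<in> borel_measurable P" "r \<in> borel_measurable P" unfolding q_def r_def by simp_all
  have Qq: "Q = density P q" unfolding q_def using density_RN_deriv_real[OF P Q ac(1) sets] .
  have "AE x in Q. q x > 0" unfolding Qq by (subst AE_density) (auto simp: q_def)
  then have "AE x in P. q x > 0" by (rule absolutely_continuous_AE[OF sets[symmetric] ac(2)])
  then have AE: "AE x in P. r x = q x" by eventually_elim (auto simp: r_def)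
  have "likelihood_ratio P Q r"
  proof (intro likelihood_ratio.intro P Q likelihood_ratio_axioms.intro)
    show "r x > 0" for x by (auto simp: r_def q_def order_less_le)
    show "Q = density P r" unfolding Qq by (rule density_cong) (use AE in auto)
    fix l :: real assume "l > 0"
    have "integrable P (\<lambda>x. q x powr l)" using mom[OF \<open>l > 0\<close>] by (simp add: q_def)
    then show "integrable P (\<lambda>x. r x powr l)"
      by (rule integrable_cong_AE_imp) (use AE in auto)
  qed measurable
  then show ?thesis by blast
qed

section \<open>Contracts under a concave utility\<close>

locale concave_utility =
  fixes wl :: real and u u' :: "real \<Rightarrow> real"
  assumes deriv: "\<And>w. w \<ge> wl \<Longrightarrow> (u has_real_derivative u' w) (at w within {wl..})"
    and marginal_pos: "\<And>w. w \<ge> wl \<Longrightarrow> u' w > 0"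
    and marginal_decreasing: "\<And>x y. wl \<le> x \<Longrightarrow> x < y \<Longrightarrow> u' y < u' x"
begin

lemma mean_value:
  assumes "wl \<le> a" "a < b"
  obtains x where "a < x" "x < b" "u b - u a = u' x * (b - a)"
proof -
  have "\<exists>x\<in>{a<..<b}. u b - u a = (*) (u' x) (b - a)"
  proof (rule mvt_simple[OF assms(2)])
    fix x assume "a \<le> x" "x \<le> b"
    then show "(u has_derivative (*) (u' x)) (at x within {a..b})"
      using deriv[of x] assms unfolding has_field_derivative_def
      by (auto intro: has_derivative_subset)
  qed
  then show ?thesis using that by auto
qed

lemma utility_mono: "wl \<le> a \<Longrightarrow> a < b \<Longrightarrow> u a < u b"
  by (metis mean_value marginal_pos diff_gt_0_iff_gt less_imp_le mult_pos_pos order.trans)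

lemma continuous_on_utility: "continuous_on {wl..} u"
  by (rule DERIV_continuous_on[where D=u']) (use deriv in auto)

lemma utility_IVT:
  assumes "wl \<le> a" "a \<le> b" "u a \<le> y" "y \<le> u b"
  obtains w where "a \<le> w" "w \<le> b" "u w = y"
  using IVT'[of u a y b] assms continuous_on_subset[OF continuous_on_utility, of "{a..b}"] by auto

lemma tangent:
  assumes "wl \<le> w" "wl \<le> W"
  shows "u w \<le> u W + u' W * (w - W)"
proof (cases w W rule: linorder_cases)
  case less
  obtain x where x: "w < x" "x < W" "u W - u w = u' x * (W - w)" using mean_value[OF assms(1) less] .
  have "u' W * (W - w) \<le> u' x * (W - w)"
    using marginal_decreasing[of x W] x assms less by (intro mult_right_mono) auto
  then show ?thesis using x by (simp add: algebra_simps)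
next
  case greater
  obtain x where x: "W < x" "x < w" "u w - u W = u' x * (w - W)" using mean_value[OF assms(2) greater] .
  have "u' x * (w - W) \<le> u' W * (w - W)"
    using marginal_decreasing[of W x] x assms greater by (intro mult_right_mono) auto
  then show ?thesis using x by (simp add: algebra_simps)
qed simp

text \<open>Quantitative strict concavity: \<open>k\<close> is the exact gap at \<open>W1\<close>
  between the tangent at \<open>W\<close> and \<open>u\<close>, and the gap grows further to the
  left, where the slope of \<open>u\<close> exceeds \<open>u' W\<close>.\<close>

lemma tangent_gap:
  assumes "wl \<le> W1" "W1 < W"
  obtains k where "k > 0" "\<And>w. wl \<le> w \<Longrightarrow> w \<le> W1 \<Longrightarrow> u w \<le> u W + u' W * (w - W) - k"
proof -
  obtain x where x: "W1 < x" "x < W" "u W - u W1 = u' x * (W - W1)" using mean_value[OF assms] .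
  define k where "k = (u' x - u' W) * (W - W1)"
  have "k > 0" unfolding k_def using marginal_decreasing[of x W] x assms by (intro mult_pos_pos) auto
  moreover have "u w \<le> u W + u' W * (w - W) - k" if w: "wl \<le> w" "w \<le> W1" for w
  proof -
    have "u' W * (w - W1) \<ge> u' W1 * (w - W1)"
      using marginal_decreasing[of W1 W] assms w by (intro mult_right_mono_neg) auto
    then have "u w \<le> u W1 + u' W * (w - W1)" using tangent[of w W1] w assms by simp
    also have "\<dots> = u W + u' W * (w - W) - k" using x(3) by (simp add: k_def algebra_simps)
    finally show ?thesis .
  qed
  ultimately show ?thesis using that by blast
qed

text \<open>On the window from \<open>W\<close> to \<open>W + 1\<close> marginal utility is at least
  \<open>u' (W + 1)\<close>, so a small rise in promised utility costs proportionally
  little.\<close>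

lemma inverse_lipschitz:
  assumes W: "wl \<le> W" and y: "u W \<le> y" "y \<le> u (W + 1)"
  obtains w where "W \<le> w" "u w = y" "w \<le> W + (y - u W) / u' (W + 1)"
proof -
  obtain w where w: "W \<le> w" "w \<le> W + 1" "u w = y" using utility_IVT[of W "W + 1" y] assms by auto
  have "u' (W + 1) * (w - W) \<le> y - u W"
  proof (cases "w = W")
    case False
    then obtain x where x: "W < x" "x < w" "u w - u W = u' x * (w - W)" using mean_value[OF W, of w] w by auto
    have "u' (W + 1) * (w - W) \<le> u' x * (w - W)"
      using marginal_decreasing[of x "W + 1"] x w W by (intro mult_right_mono) auto
    then show ?thesis using x w by simp
  qed (use w in simp)
  then have "w - W \<le> (y - u W) / u' (W + 1)"
    using marginal_pos[of "W + 1"] W by (simp add: field_simps)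
  then show ?thesis using that[of w] w by simp
qed

end

text \<open>\<open>W\<close> is the first-best wage.\<close>
locale agency = concave_utility wl u u'
  for wl :: real and u u' :: "real \<Rightarrow> real" +
  fixes A :: "'a set" and \<mu> :: "'a \<Rightarrow> 'x measure" and c :: "'a \<Rightarrow> real" and as ah :: 'a and W :: real
  assumes finA: "finite A" and as_in: "as \<in> A" and ah_in: "ah \<in> A"
    and prob: "\<And>a. a \<in> A \<Longrightarrow> prob_space (\<mu> a)"
    and sets_eq: "\<And>a. a \<in> A \<Longrightarrow> sets (\<mu> a) = sets (\<mu> as)"
    and ah_min: "\<And>a. a \<in> A \<Longrightarrow> a \<noteq> ah \<Longrightarrow> c ah < c a"
    and c_ne: "\<And>a. a \<in> A \<Longrightarrow> a \<noteq> as \<Longrightarrow> c as \<noteq> c a"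
    and ah_as: "c ah < c as" and ah_le: "c ah \<le> u wl"
    and W: "wl < W" "u W = u wl + (c as - c ah)"
begin

section \<open>Lower bounds on the excess cost of feasible contracts\<close>

lemma sets_signals: "a \<in> A \<Longrightarrow> sets (signals \<mu> a n) = sets (signals \<mu> as n)"
  unfolding signals_def by (intro sets_PiM_cong) (auto simp: sets_eq)

lemma space_signals: "a \<in> A \<Longrightarrow> space (signals \<mu> a n) = space (signals \<mu> as n)"
  by (rule sets_eq_imp_space_eq) (rule sets_signals)

lemma prob_signals: "a \<in> A \<Longrightarrow> prob_space (signals \<mu> a n)"
  unfolding signals_def by (intro prob_space_PiM prob)

text \<open>The cutoff \<open>W1\<close> is left free: for the Chernoff bound it can lie anywhere
  strictly between \<open>wl\<close> and \<open>W\<close>, whereas the Stein bound must adapt it to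
  the cost of the deviation.\<close>

context
  fixes W1 k :: real and n :: nat and w :: "(nat \<Rightarrow> 'x) \<Rightarrow> real" and B :: "(nat \<Rightarrow> 'x) set" and X :: real
  assumes W1: "wl \<le> W1" "W1 < W"
    and gap: "\<And>w. wl \<le> w \<Longrightarrow> w \<le> W1 \<Longrightarrow> u w \<le> u W + u' W * (w - W) - k"
    and w: "w \<in> feasible A \<mu> wl u c as n"
  defines "B \<equiv> {x\<in>space (signals \<mu> as n). w x \<le> W1}"
    and "X \<equiv> (\<integral>x. w x \<partial>signals \<mu> as n) - W"
begin

lemma low_wage_set: "B \<in> sets (signals \<mu> as n)"
proof -
  have [measurable]: "w \<in> borel_measurable (signals \<mu> as n)" using w by (simp add: feasible_def)
  show ?thesis unfolding B_def by measurable
qed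

text \<open>The tangent at \<open>W\<close> bounds utility pointwise, with a further loss of
  \<open>k\<close> on the low-wage event.\<close>

lemma expected_utility_le:
  "(\<integral>x. u (w x) \<partial>signals \<mu> as n) \<le> u W + u' W * X - k * measure (signals \<mu> as n) B"
proof -
  interpret S: prob_space "signals \<mu> as n" by (rule prob_signals) (rule as_in)
  have iB: "integrable (signals \<mu> as n) (indicat_real B)"
      "(\<integral>x. indicat_real B x \<partial>signals \<mu> as n) = measure (signals \<mu> as n) B"
    using low_wage_set by (simp_all add: integrable_indicator_iff S.emeasure_eq_measure)
  have i: "integrable (signals \<mu> as n) w" "integrable (signals \<mu> as n) (\<lambda>x. u (w x))"
    "\<And>x. x \<in> space (signals \<mu> as n) \<Longrightarrow> wl \<le> w x"
    using w as_in by (auto simp: feasible_def)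
  have "(\<integral>x. u (w x) \<partial>signals \<mu> as n) \<le> (\<integral>x. u W + u' W * (w x - W) - k * indicator B x \<partial>signals \<mu> as n)"
  proof (rule integral_mono)
    fix x assume x: "x \<in> space (signals \<mu> as n)"
    show "u (w x) \<le> u W + u' W * (w x - W) - k * indicator B x"
      using gap[of "w x"] tangent[of "w x" W] i(3)[OF x] x W by (auto simp: B_def indicator_def)
  qed (use i iB in auto)
  also have "\<dots> = u W + u' W * X - k * measure (signals \<mu> as n) B"
    using i iB by (simp add: S.prob_space X_def)
  finally show ?thesis .
qed

lemma expected_utility_ge:
  assumes a: "a \<in> A"
  shows "u wl + (u W1 - u wl) * (1 - measure (signals \<mu> a n) B) \<le> (\<integral>x. u (w x) \<partial>signals \<mu> a n)"
proof -
  interpret S: prob_space "signals \<mu> a n" by (rule prob_signals) fact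
  have iB: "integrable (signals \<mu> a n) (indicat_real B)"
      "(\<integral>x. indicat_real B x \<partial>signals \<mu> a n) = measure (signals \<mu> a n) B"
    using low_wage_set sets_signals[OF a] by (simp_all add: integrable_indicator_iff S.emeasure_eq_measure)
  have i: "integrable (signals \<mu> a n) (\<lambda>x. u (w x))"
    "\<And>x. x \<in> space (signals \<mu> a n) \<Longrightarrow> wl \<le> w x"
    using w a space_signals[OF a] by (auto simp: feasible_def)
  have "u wl + (u W1 - u wl) * (1 - measure (signals \<mu> a n) B)
    = (\<integral>x. u wl + (u W1 - u wl) * (1 - indicator B x) \<partial>signals \<mu> a n)"
    using iB by (simp add: S.prob_space)
  also have "\<dots> \<le> (\<integral>x. u (w x) \<partial>signals \<mu> a n)"
  proof (rule integral_mono)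
    fix x assume x: "x \<in> space (signals \<mu> a n)"
    have "u wl \<le> u (w x)" using utility_mono[of wl "w x"] i(2)[OF x] by (cases "w x = wl") auto
    moreover have "u W1 \<le> u (w x)" if "w x > W1" using utility_mono[of W1 "w x"] W1 that by simp
    ultimately show "u wl + (u W1 - u wl) * (1 - indicator B x) \<le> u (w x)"
      using x space_signals[OF a] by (auto simp: B_def indicator_def)
  qed (use i iB in auto)
  finally show ?thesis .
qed

text \<open>Insert the upper bound for \<open>as\<close> and the lower bound for \<open>ah\<close>
  into the incentive constraint. By the definition of \<open>W\<close> all constant terms cancel,
  leaving only the two errors and the excess.\<close>

lemma excess_ge_error_sum:
  "k * measure (signals \<mu> as n) B
     + (u W1 - u wl) * measure (signals \<mu> ah n) (space (signals \<mu> as n) - B) \<le> u' W * X"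
proof -
  interpret S: prob_space "signals \<mu> ah n" by (rule prob_signals) (rule ah_in)
  have "measure (signals \<mu> ah n) (space (signals \<mu> as n) - B) = 1 - measure (signals \<mu> ah n) B"
    using S.prob_compl[of B] low_wage_set sets_signals[OF ah_in] space_signals[OF ah_in] by simp
  moreover have "(\<integral>x. u (w x) \<partial>signals \<mu> as n) - c as \<ge> (\<integral>x. u (w x) \<partial>signals \<mu> ah n) - c ah"
    using w ah_in by (auto simp: feasible_def)
  ultimately show ?thesis using expected_utility_le expected_utility_ge[OF ah_in] W(2) by simp
qed

text \<open>The same comparison against \<open>a\<close> leaves the slack \<open>c a - c ah\<close>.
  It is informative once \<open>u W1 - u wl\<close> exceeds that slack: a small excess then forces
  low wages with a fixed probability under \<open>a\<close>.\<close>

lemma excess_or_low_wage: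
  assumes a: "a \<in> A" and k0: "k \<ge> 0"
  shows "(u W1 - u wl) * (1 - measure (signals \<mu> a n) B) \<le> c a - c ah + u' W * X"
proof -
  have "(\<integral>x. u (w x) \<partial>signals \<mu> as n) - c as \<ge> (\<integral>x. u (w x) \<partial>signals \<mu> a n) - c a"
    using w a by (auto simp: feasible_def)
  moreover have "k * measure (signals \<mu> as n) B \<ge> 0" using k0 by simp
  ultimately show ?thesis using expected_utility_le expected_utility_ge[OF a] W(2) by simp
qed

end

lemma excess_lower_Chernoff:
  assumes N: "prob_space N" "sets N = sets (\<mu> as)"
    and t: "KL N (\<mu> as) < ereal t" "KL N (\<mu> ah) < ereal t"
  shows "\<exists>C>0. \<forall>\<^sub>F n in sequentially. \<forall>w\<in>feasible A \<mu> wl u c as n.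
    C * exp (- t * real n) \<le> (\<integral>x. w x \<partial>signals \<mu> as n) - W"
proof -
  define W1 where "W1 = (wl + W) / 2"
  have W1: "wl \<le> W1" "W1 < W" "wl < W1" using W by (auto simp: W1_def)
  obtain k where k: "k > 0" and gap: "\<And>w. wl \<le> w \<Longrightarrow> w \<le> W1 \<Longrightarrow> u w \<le> u W + u' W * (w - W) - k"
    using tangent_gap[OF W1(1,2)] by blast
  define m where "m = min k (u W1 - u wl)"
  have m: "m > 0" "m \<le> k" "m \<le> u W1 - u wl" using k utility_mono[of wl W1] W1 by (auto simp: m_def)
  have d: "u' W > 0" using marginal_pos W by simp
  have "\<forall>\<^sub>F n in sequentially. \<forall>B\<in>sets (iid (\<mu> as) n). exp (- t * real n) / 4
      \<le> measure (iid (\<mu> as) n) B + measure (iid (\<mu> ah) n) (space (iid (\<mu> as) n) - B)"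
    using chernoff_lower[OF prob[OF as_in] prob[OF ah_in] N(1) _ _ t] N(2) sets_eq[OF ah_in] by simp
  then have "\<forall>\<^sub>F n in sequentially. \<forall>w\<in>feasible A \<mu> wl u c as n.
    m / (4 * u' W) * exp (- t * real n) \<le> (\<integral>x. w x \<partial>signals \<mu> as n) - W"
  proof eventually_elim
    case (elim n)
    show ?case
    proof
      fix w assume w: "w \<in> feasible A \<mu> wl u c as n"
      define B where "B = {x\<in>space (signals \<mu> as n). w x \<le> W1}"
      have "exp (- t * real n) / 4 \<le> measure (signals \<mu> as n) B
          + measure (signals \<mu> ah n) (space (signals \<mu> as n) - B)"
        using elim low_wage_set[OF W1(1,2) gap w] unfolding signals_def B_def by blast
      then have "m * (exp (- t * real n) / 4) \<le> m * measure (signals \<mu> as n) B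
          + m * measure (signals \<mu> ah n) (space (signals \<mu> as n) - B)"
        using m(1) by (simp flip: distrib_left)
      also have "\<dots> \<le> k * measure (signals \<mu> as n) B
          + (u W1 - u wl) * measure (signals \<mu> ah n) (space (signals \<mu> as n) - B)"
        using m by (intro add_mono mult_right_mono) auto
      also have "\<dots> \<le> u' W * ((\<integral>x. w x \<partial>signals \<mu> as n) - W)"
        unfolding B_def by (rule excess_ge_error_sum[OF W1(1,2) gap w])
      finally show "m / (4 * u' W) * exp (- t * real n) \<le> (\<integral>x. w x \<partial>signals \<mu> as n) - W"
        using d by (simp add: field_simps)
    qed
  qed
  moreover have "m / (4 * u' W) > 0" using m d by simp
  ultimately show ?thesis by blast
qed

lemma excess_lower_Stein:
  assumes a: "a \<in> A" "c a < c as" and t: "KL (\<mu> a) (\<mu> as) < ereal t" "0 \<le> t"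
  shows "\<exists>C>0. \<forall>\<^sub>F n in sequentially. \<forall>w\<in>feasible A \<mu> wl u c as n.
    C * exp (- t * real n) \<le> (\<integral>x. w x \<partial>signals \<mu> as n) - W"
proof -
  \<comment> \<open>\<open>y\<close> is the utility gain at the cutoff: above
    \<open>c a - c ah\<close>, so that low wages are forced under \<open>a\<close>, and below
    \<open>c as - c ah\<close>, so that the cutoff stays below \<open>W\<close>.\<close>
  define y where "y = ((c a - c ah) + (c as - c ah)) / 2"
  have ca: "c ah \<le> c a" using ah_min[OF a(1)] by (cases "a = ah") auto
  have y: "c a - c ah < y" "y < c as - c ah" "y > 0" using a ca by (auto simp: y_def)
  obtain W1 where W1': "wl \<le> W1" "W1 \<le> W" "u W1 = u wl + y" using utility_IVT[of wl W "u wl + y"] W y by auto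
  have W1: "wl \<le> W1" "W1 < W" using W1' W y by (auto simp: order_less_le)
  obtain k where k: "k > 0" and gap: "\<And>w. wl \<le> w \<Longrightarrow> w \<le> W1 \<Longrightarrow> u w \<le> u W + u' W * (w - W) - k"
    using tangent_gap[OF W1] by blast
  have d: "u' W > 0" using marginal_pos W by simp
  \<comment> \<open>Half of the gap between \<open>y\<close> and the slack is conceded to the
    excess; the other half forces a low-wage probability of at least \<open>e / y\<close> under
    \<open>a\<close>.\<close>
  define e where "e = (y - (c a - c ah)) / 2"
  have e: "e > 0" using y by (simp add: e_def)
  define m where "m = min e (k * (e / y / 2))"
  have m: "m > 0" "m \<le> e" "m \<le> k * (e / y / 2)" using e k y by (auto simp: m_def min_def)
  have "\<forall>\<^sub>F n in sequentially. \<forall>B\<in>sets (iid (\<mu> as) n). e / y \<le> measure (iid (\<mu> a) n) B \<longrightarrow>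
    e / y / 2 * exp (- t * real n) \<le> measure (iid (\<mu> as) n) B"
    by (rule stein_lower[OF prob[OF as_in] prob[OF a(1)] t(1)]) (use e y in simp)
  then have "\<forall>\<^sub>F n in sequentially. \<forall>w\<in>feasible A \<mu> wl u c as n.
    m / u' W * exp (- t * real n) \<le> (\<integral>x. w x \<partial>signals \<mu> as n) - W"
  proof eventually_elim
    case (elim n)
    show ?case
    proof
      fix w assume w: "w \<in> feasible A \<mu> wl u c as n"
      define B where "B = {x\<in>space (signals \<mu> as n). w x \<le> W1}"
      define X where "X = (\<integral>x. w x \<partial>signals \<mu> as n) - W"
      have low: "y * (1 - measure (signals \<mu> a n) B) \<le> c a - c ah + u' W * X"
        using excess_or_low_wage[OF W1 gap w a(1)] k W1'(3) by (simp add: B_def X_def)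
      have "m * exp (- t * real n) \<le> u' W * X"
      proof (cases "u' W * X \<le> e")
        case True
        then have "e \<le> y * measure (signals \<mu> a n) B" using low by (simp add: e_def algebra_simps)
        then have "e / y \<le> measure (signals \<mu> a n) B" using y by (simp add: field_simps)
        then have P: "e / y / 2 * exp (- t * real n) \<le> measure (signals \<mu> as n) B"
          using elim low_wage_set[OF W1 gap w] unfolding signals_def B_def by blast
        have "m * exp (- t * real n) \<le> k * (e / y / 2) * exp (- t * real n)"
          using m by (intro mult_right_mono) auto
        also have "\<dots> \<le> k * measure (signals \<mu> as n) B"
          using mult_left_mono[OF P, of k] k by simp
        also have "\<dots> \<le> k * measure (signals \<mu> as n) B
            + (u W1 - u wl) * measure (signals \<mu> ah n) (space (signals \<mu> as n) - B)"
          using W1'(3) y by simp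
        also have "\<dots> \<le> u' W * X"
          unfolding B_def X_def by (rule excess_ge_error_sum[OF W1 gap w])
        finally show ?thesis .
      next
        case False
        \<comment> \<open>An excess above the constant \<open>e\<close> is already enough, because
          \<open>t >= 0\<close> makes the exponential at most 1.\<close>
        have "m * exp (- t * real n) \<le> m * 1" using m t(2) by (intro mult_left_mono) auto
        then show ?thesis using False m by linarith
      qed
      then show "m / u' W * exp (- t * real n) \<le> (\<integral>x. w x \<partial>signals \<mu> as n) - W"
        using d by (simp add: X_def field_simps)
    qed
  qed
  moreover have "m / u' W > 0" using m d by simp
  ultimately show ?thesis by blast
qed

end

section \<open>Upper bound: intersected tests and two-wage contracts\<close>

lemma test_rate_combine:
  assumes P: "prob_space P" and fin: "finite S" and ne: "S \<noteq> {}"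
    and Q: "\<And>a. a \<in> S \<Longrightarrow> prob_space (Q a)" "\<And>a. a \<in> S \<Longrightarrow> sets (Q a) = sets P"
    and B: "\<And>a. a \<in> S \<Longrightarrow> test_rate P (Q a) t (B a)" and a: "a \<in> S"
  shows "test_rate P (Q a) t (\<lambda>n. \<Inter>a\<in>S. B a n)"
proof -
  let ?I = "\<lambda>n. \<Inter>a\<in>S. B a n"
  let ?e = "\<lambda>n. measure (iid P n) (space (iid P n) - ?I n)"
  \<comment> \<open>Union bound: intersecting finitely many tests adds up their errors under
    \<open>P\<close>, which keeps the rate, and can only decrease the error under each
    \<open>Q a\<close>.\<close>
  let ?E = "\<lambda>n. \<Sum>a\<in>S. measure (iid P n) (space (iid P n) - B a n)"
  have meas: "B a n \<in> sets (iid P n)" if "a \<in> S" for a n using B[OF that] by (simp add: test_rate_def)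
  have I: "?I n \<in> sets (iid P n)" for n using fin ne meas by auto
  have le: "?e n \<le> ?E n" for n
  proof -
    have "?e n = measure (iid P n) (\<Union>a\<in>S. space (iid P n) - B a n)" using ne by (intro arg_cong[where f="measure (iid P n)"]) auto
    also have "\<dots> \<le> ?E n" using fin meas by (intro measure_UNION_le) auto
    finally show ?thesis .
  qed
  have "?E \<longlonglongrightarrow> 0"
    by (intro tendsto_null_sum) (use B in \<open>simp add: test_rate_def\<close>)
  then have 1: "?e \<longlonglongrightarrow> 0"
    by (rule tendsto_sandwich[OF _ _ tendsto_const, rotated 2]) (simp_all add: le)
  have "(\<lambda>n. exp (t * real n) * ?E n) \<longlonglongrightarrow> 0"
    unfolding sum_distrib_left by (intro tendsto_null_sum) (use B in \<open>simp add: test_rate_def\<close>)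
  then have 2: "(\<lambda>n. exp (t * real n) * ?e n) \<longlonglongrightarrow> 0"
    by (rule tendsto_sandwich[OF _ _ tendsto_const, rotated 2]) (simp_all add: le)
  have 3: "(\<lambda>n. measure (iid (Q a) n) (?I n)) \<longlonglongrightarrow> 0"
  proof (rule tendsto_sandwich[OF _ _ tendsto_const])
    show "(\<lambda>n. measure (iid (Q a) n) (B a n)) \<longlonglongrightarrow> 0" using B[OF a] by (simp add: test_rate_def)
    have "measure (iid (Q a) n) (?I n) \<le> measure (iid (Q a) n) (B a n)" for n
    proof -
      interpret prob_space "iid (Q a) n" by (rule prob_space_iid) (rule Q(1)[OF a])
      have "sets (iid (Q a) n) = sets (iid P n)" by (intro sets_PiM_cong) (auto simp: Q(2)[OF a])
      then show ?thesis using a meas[OF a] by (intro finite_measure_mono) auto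
    qed
    then show "\<forall>\<^sub>F n in sequentially. measure (iid (Q a) n) (?I n) \<le> measure (iid (Q a) n) (B a n)" by simp
  qed simp
  show ?thesis unfolding test_rate_def using I 1 2 3 by auto
qed

context agency
begin

lemma binary_contract:
  fixes K wK :: real and n :: nat and B :: "(nat \<Rightarrow> 'x) set"
  defines "p \<equiv> \<lambda>a. measure (signals \<mu> a n) B"
  assumes B: "B \<in> sets (signals \<mu> as n)"
    and wK: "wl < wK" "u wK = u wl + K" and err: "p ah < p as" and K: "K * (p as - p ah) = c as - c ah"
    and IC: "\<And>a. a \<in> A \<Longrightarrow> c as - c a \<le> K * (p as - p a)"
  shows "\<exists>w\<in>feasible_bin A \<mu> wl u c as n. (\<integral>x. w x \<partial>signals \<mu> as n) \<le> wK"
proof -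
  define w where "w x = wl + (wK - wl) * indicat_real B x" for x
  have uw: "u (w x) = u wl + K * indicat_real B x" for x by (simp add: w_def wK indicator_def)
  have prob: "prob_space (signals \<mu> a n)" if "a \<in> A" for a using prob_signals[OF that] .
  have i: "integrable (signals \<mu> a n) (indicat_real B)" "(\<integral>x. indicat_real B x \<partial>signals \<mu> a n) = p a"
    "emeasure (signals \<mu> a n) (space (signals \<mu> a n)) = 1" "measure (signals \<mu> a n) (space (signals \<mu> a n)) = 1"
    if "a \<in> A" for a
  proof -
    interpret S: prob_space "signals \<mu> a n" using prob[OF that] .
    show "integrable (signals \<mu> a n) (indicat_real B)" "(\<integral>x. indicat_real B x \<partial>signals \<mu> a n) = p a"
      using B sets_signals[OF that] by (simp_all add: integrable_indicator_iff S.emeasure_eq_measure p_def)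
    show "emeasure (signals \<mu> a n) (space (signals \<mu> a n)) = 1" "measure (signals \<mu> a n) (space (signals \<mu> a n)) = 1"
      by (simp_all add: S.emeasure_space_1 S.prob_space)
  qed
  have const: "integrable (signals \<mu> a n) (\<lambda>x. y)" if "a \<in> A" for a and y :: real
    using i(3)[OF that] by (simp add: integrable_iff_bounded ennreal_mult_less_top)
  have Eu: "integrable (signals \<mu> a n) (\<lambda>x. u (w x))" "(\<integral>x. u (w x) \<partial>signals \<mu> a n) = u wl + K * p a"
    if "a \<in> A" for a
    unfolding uw using i[OF that] const[OF that] by simp_all
  have Ew: "integrable (signals \<mu> as n) w" "(\<integral>x. w x \<partial>signals \<mu> as n) = wl + (wK - wl) * p as"
    unfolding w_def using i[OF as_in] const[OF as_in] by simp_all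
  have K0: "K > 0" using K err ah_as by (metis diff_gt_0_iff_gt zero_less_mult_pos2)
  \<comment> \<open>Participation follows from the binding constraint for \<open>ah\<close>: it
    makes \<open>K * p as\<close> cover \<open>c as - c ah\<close>, and \<open>c ah <= u wl\<close>
    covers the rest.\<close>
  have "p ah \<ge> 0" by (simp add: p_def)
  then have IR: "K * p as \<ge> c as - c ah" using K K0 mult_left_mono[of 0 "p ah" K] by (simp add: algebra_simps)
  have w_feas: "w \<in> feasible A \<mu> wl u c as n"
    unfolding feasible_def
  proof (intro CollectI conjI ballI)
    fix a assume a: "a \<in> A"
    show "(\<integral>x. u (w x) \<partial>signals \<mu> a n) - c a \<le> (\<integral>x. u (w x) \<partial>signals \<mu> as n) - c as"
      using IC[OF a] by (simp add: Eu a as_in algebra_simps)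
  qed (use Ew Eu as_in IR ah_le wK in \<open>auto simp: w_def indicator_def\<close>)
  have "w ` space (signals \<mu> as n) = {wl, wK}"
  proof -
    \<comment> \<open>Both wages are really paid: \<open>err\<close> is strict, so \<open>B\<close>
      is neither empty nor the whole space.\<close>
    have "B \<noteq> {}" using err by (auto simp: p_def)
    moreover have "space (signals \<mu> as n) - B \<noteq> {}"
    proof
      assume "space (signals \<mu> as n) - B = {}"
      then have "B = space (signals \<mu> as n)" using sets.sets_into_space[OF B] by auto
      then have "p as = 1" "p ah = 1" using i(4)[OF as_in] i(4)[OF ah_in] by (simp_all add: p_def space_signals[OF ah_in])
      then show False using err by simp
    qed
    ultimately obtain x y where xy: "x \<in> B" "x \<in> space (signals \<mu> as n)" "y \<in> space (signals \<mu> as n)" "y \<notin> B"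
      using sets.sets_into_space[OF B] by blast
    then have "w x = wK" "w y = wl" by (simp_all add: w_def)
    moreover have "w z \<in> {wl, wK}" for z by (simp add: w_def indicator_def)
    ultimately show ?thesis using xy by blast
  qed
  then have "card (w ` space (signals \<mu> as n)) = 2" using wK by simp
  moreover have "(\<integral>x. w x \<partial>signals \<mu> as n) \<le> wK"
  proof -
    interpret S: prob_space "signals \<mu> as n" using prob[OF as_in] .
    have "(wK - wl) * p as \<le> (wK - wl) * 1" using wK by (intro mult_left_mono) (auto simp: p_def)
    then show ?thesis using Ew(2) by simp
  qed
  ultimately show ?thesis using w_feas by (auto simp: feasible_bin_def)
qed

text \<open>Binding incentives for \<open>ah\<close> scale the first-best bonus \<open>D\<close>, in
  utility, by \<open>1 / (1 - \<eta> n)\<close>, where \<open>\<eta> n\<close> is the sum of the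
  errors against \<open>ah\<close>. The excess is thus of order \<open>\<eta> n\<close>, and the
  errors under other cheaper actions do not enter it.\<close>

lemma excess_upper:
  assumes tests: "\<And>a. a \<in> A \<Longrightarrow> c a < c as \<Longrightarrow> test_rate (\<mu> as) (\<mu> a) t B"
    and ah: "(\<lambda>n. exp (t * real n) * measure (iid (\<mu> ah) n) (B n)) \<longlonglongrightarrow> 0"
  shows "\<forall>\<^sub>F n in sequentially. \<exists>w\<in>feasible_bin A \<mu> wl u c as n.
    (\<integral>x. w x \<partial>signals \<mu> as n) \<le> W + exp (- t * real n)"
proof -
  define D where "D = c as - c ah"
  have D: "D > 0" using ah_as by (simp add: D_def)
  define p where "p a n = measure (signals \<mu> a n) (B n)" for a n
  define \<alpha> where "\<alpha> n = 1 - p as n" for n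
  have B: "B n \<in> sets (signals \<mu> as n)" for n
    using tests[OF ah_in ah_as] by (auto simp: test_rate_def signals_def)
  have \<alpha>_eq: "\<alpha> n = measure (iid (\<mu> as) n) (space (iid (\<mu> as) n) - B n)" for n
  proof -
    interpret S: prob_space "signals \<mu> as n" by (rule prob_signals) (rule as_in)
    show ?thesis using S.prob_compl[OF B] by (simp add: \<alpha>_def p_def signals_def)
  qed
  have \<alpha>: "\<alpha> \<longlonglongrightarrow> 0" "(\<lambda>n. exp (t * real n) * \<alpha> n) \<longlonglongrightarrow> 0" "\<alpha> n \<ge> 0" for n
    using tests[OF ah_in ah_as] by (auto simp: test_rate_def \<alpha>_eq[abs_def])
  have p: "p a \<longlonglongrightarrow> 0" if "a \<in> A" "c a < c as" for a
    using tests[OF that] by (simp add: test_rate_def p_def[abs_def] signals_def)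
  have pbd: "0 \<le> p a n" "a \<in> A \<Longrightarrow> p a n \<le> 1" for a n
    using prob_space.prob_le_1[OF prob_signals] by (auto simp: p_def)
  define \<eta> where "\<eta> n = \<alpha> n + p ah n" for n
  have \<eta>: "\<eta> \<longlonglongrightarrow> 0" "\<eta> n \<ge> 0" for n
    using tendsto_add[OF \<alpha>(1) p[OF ah_in ah_as]] \<alpha>(3)[of n] pbd(1) by (auto simp: \<eta>_def[abs_def])
  have \<eta>t: "(\<lambda>n. exp (t * real n) * \<eta> n) \<longlonglongrightarrow> 0"
    using tendsto_add[OF \<alpha>(2) ah] by (simp add: \<eta>_def p_def signals_def distrib_left)
  define m where "m = u' (W + 1)"
  have m: "m > 0" using marginal_pos[of "W + 1"] W by (simp add: m_def)
  have up: "u W < u (W + 1)" using utility_mono[of W "W + 1"] W by simp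
  \<comment> \<open>Below 1/2 the bonus satisfies \<open>K - D <= 2 * D * \<eta> n\<close> and
    \<open>K <= 2 * D\<close>; the second bound keeps the promised utility below
    \<open>u (W + 1)\<close>. In \<open>ev2\<close>, the factor \<open>m / (2 * D)\<close> turns
    extra utility into extra wage.\<close>
  have ev1: "\<forall>\<^sub>F n in sequentially. \<eta> n < min (1/2) ((u (W + 1) - u W) / (2 * D))"
    by (rule order_tendstoD(2)[OF \<eta>(1)]) (use up D in simp)
  have ev2: "\<forall>\<^sub>F n in sequentially. exp (t * real n) * \<eta> n < m / (2 * D)"
    by (rule order_tendstoD(2)[OF \<eta>t]) (use m D in simp)
  \<comment> \<open>The right-hand side equals \<open>(c a - c ah) / D > 0\<close>, the slack of a
    cheaper action other than \<open>ah\<close>.\<close>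
  have ev3: "\<forall>\<^sub>F n in sequentially. \<forall>a\<in>A. a \<noteq> ah \<longrightarrow> c a < c as \<longrightarrow> \<alpha> n + p a n < 1 - (c as - c a) / D"
  proof (intro eventually_ball_finite[OF finA] ballI)
    fix a assume a: "a \<in> A"
    show "\<forall>\<^sub>F n in sequentially. a \<noteq> ah \<longrightarrow> c a < c as \<longrightarrow> \<alpha> n + p a n < 1 - (c as - c a) / D"
    proof (cases "a \<noteq> ah \<and> c a < c as")
      case True
      have "(\<lambda>n. \<alpha> n + p a n) \<longlonglongrightarrow> 0" using tendsto_add[OF \<alpha>(1) p[OF a]] True by simp
      then have "\<forall>\<^sub>F n in sequentially. \<alpha> n + p a n < 1 - (c as - c a) / D"
        by (rule order_tendstoD) (use True ah_min[OF a] D in \<open>simp add: D_def\<close>)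
      then show ?thesis by eventually_elim simp
    qed auto
  qed
  \<comment> \<open>Against a costlier action the test may work in the wrong direction, but the gain
    from deviating is at most \<open>K * \<alpha> n <= 2 * D * \<alpha> n\<close>, eventually below
    the extra effort cost.\<close>
  have ev4: "\<forall>\<^sub>F n in sequentially. \<forall>a\<in>A. c as < c a \<longrightarrow> \<alpha> n < (c a - c as) / (2 * D)"
  proof (intro eventually_ball_finite[OF finA] ballI)
    fix a assume a: "a \<in> A"
    show "\<forall>\<^sub>F n in sequentially. c as < c a \<longrightarrow> \<alpha> n < (c a - c as) / (2 * D)"
    proof (cases "c as < c a")
      case True
      have "\<forall>\<^sub>F n in sequentially. \<alpha> n < (c a - c as) / (2 * D)"
        by (rule order_tendstoD(2)[OF \<alpha>(1)]) (use True D in simp)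
      then show ?thesis by eventually_elim simp
    qed auto
  qed
  show ?thesis using ev1 ev2 ev3 ev4
  proof eventually_elim
    case (elim n)
    define K where "K = D / (1 - \<eta> n)"
    have h: "\<eta> n < 1/2" "\<eta> n * (2 * D) \<le> u (W + 1) - u W" using elim(1) D by (auto simp: field_simps)
    have pd: "p as n - p ah n = 1 - \<eta> n" by (simp add: \<eta>_def \<alpha>_def)
    have KD: "K - D = D * \<eta> n / (1 - \<eta> n)" using h by (simp add: K_def field_simps)
    have "D * \<eta> n / (1 - \<eta> n) \<le> D * \<eta> n / (1/2)"
      using h D \<eta>(2)[of n] by (intro divide_left_mono) auto
    then have K2: "K - D \<le> 2 * D * \<eta> n" using KD by simp
    have "0 \<le> D * \<eta> n / (1 - \<eta> n)"
      using D h \<eta>(2)[of n] by (intro divide_nonneg_pos mult_nonneg_nonneg) auto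
    then have K1: "D \<le> K" using KD by linarith
    have K3: "K \<le> 2 * D" 
    proof -
      have "2 * D * \<eta> n \<le> 2 * D * (1/2)" using h D by (intro mult_left_mono) auto
      then show ?thesis using K2 by simp
    qed
    have y: "u W \<le> u wl + K" "u wl + K \<le> u (W + 1)"
      using K1 K2 h W by (simp_all add: D_def algebra_simps)
    obtain wK where wK: "W \<le> wK" "u wK = u wl + K" "wK \<le> W + (u wl + K - u W) / m"
      using inverse_lipschitz[OF _ y] W unfolding m_def by auto
    have "(u wl + K - u W) / m \<le> 2 * D * \<eta> n / m"
      using K2 W m by (intro divide_right_mono) (auto simp: D_def)
    also have "\<dots> \<le> exp (- t * real n)"
      using elim(2) m D by (simp add: field_simps exp_minus)
    finally have cost: "wK \<le> W + exp (- t * real n)" using wK(3) by simp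
    have "\<exists>w\<in>feasible_bin A \<mu> wl u c as n. (\<integral>x. w x \<partial>signals \<mu> as n) \<le> wK"
    proof (rule binary_contract[OF B])
      show "wl < wK" using wK W by simp
      show "u wK = u wl + K" by fact
      show "measure (signals \<mu> ah n) (B n) < measure (signals \<mu> as n) (B n)"
        using pd h by (simp add: p_def)
      show K_eq: "K * (measure (signals \<mu> as n) (B n) - measure (signals \<mu> ah n) (B n)) = c as - c ah"
        using pd h by (simp add: p_def K_def D_def)
      fix a assume a: "a \<in> A"
      show "c as - c a \<le> K * (measure (signals \<mu> as n) (B n) - measure (signals \<mu> a n) (B n))"
        unfolding p_def[symmetric]
      proof (cases "a = as \<or> a = ah")
        case True
        then show "c as - c a \<le> K * (p as n - p a n)" using K_eq by (auto simp: p_def)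
      next
        case False
        consider "c a < c as" | "c as < c a" using c_ne[OF a] False by force
        then show "c as - c a \<le> K * (p as n - p a n)"
        proof cases
          case 1
          then have q: "(c as - c a) / D < p as n - p a n"
            using elim(3) a False by (auto simp: \<alpha>_def)
          have "0 < (c as - c a) / D" using 1 D by simp
          then have "p as n - p a n > 0" using q by linarith
          moreover have "c as - c a < D * (p as n - p a n)"
            using q D by (simp add: pos_divide_less_eq mult.commute)
          ultimately show ?thesis using mult_right_mono[OF K1, of "p as n - p a n"] by linarith
        next
          case 2
          then have "\<alpha> n * (2 * D) \<le> c a - c as" using elim(4) a D by (auto simp: field_simps)
          moreover have "K * \<alpha> n \<le> 2 * D * \<alpha> n" using K3 \<alpha>(3) by (intro mult_right_mono) auto
          moreover have "K * (- \<alpha> n) \<le> K * (p as n - p a n)"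
            using pbd(2)[OF a, of n] K1 D by (intro mult_left_mono) (auto simp: \<alpha>_def)
          ultimately show ?thesis by (simp add: algebra_simps)
        qed
      qed
    qed
    then show ?case using cost by (meson order.trans)
  qed
qed

end

section \<open>From cost bounds to the exponential rate\<close>

lemma exponential_rate_tendsto:
  fixes f :: "nat \<Rightarrow> real" and \<rho> :: ereal
  assumes lower: "\<And>t. \<rho> < ereal t \<Longrightarrow> \<forall>\<^sub>F n in sequentially. exp (- t * real n) \<le> f n"
    and upper: "\<And>t. ereal t < \<rho> \<Longrightarrow> \<forall>\<^sub>F n in sequentially. f n \<le> exp (- t * real n)"
    and pos: "\<forall>\<^sub>F n in sequentially. 0 < f n"
  shows "(\<lambda>n. ereal (ln (f n) / real n)) \<longlonglongrightarrow> - \<rho>"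
proof (rule order_tendstoI)
  fix y assume "y < - \<rho>"
  then obtain z where z: "y < ereal z" "ereal z < - \<rho>" using ereal_dense2 by blast
  have "\<rho> < ereal (- z)" using z(2) by (metis ereal_less_uminus_reorder uminus_ereal.simps(1))
  from lower[OF this] have "\<forall>\<^sub>F n in sequentially. exp (z * real n) \<le> f n" by simp
  then show "\<forall>\<^sub>F n in sequentially. y < ereal (ln (f n) / real n)"
    using eventually_gt_at_top[of 0]
  proof eventually_elim
    case (elim n)
    have "z * real n \<le> ln (f n)" using elim(1) by (metis exp_gt_zero ln_exp ln_mono order.strict_trans2)
    then have "z \<le> ln (f n) / real n" using elim(2) by (simp add: field_simps)
    then show ?case using z(1) by (metis ereal_less_eq(3) order.strict_trans2)
  qed
next
  fix y assume "- \<rho> < y"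
  then obtain z where z: "- \<rho> < ereal z" "ereal z < y" using ereal_dense2 by blast
  have "ereal (- z) < \<rho>" using z(1) by (metis ereal_uminus_less_reorder uminus_ereal.simps(1))
  from upper[OF this] have "\<forall>\<^sub>F n in sequentially. f n \<le> exp (z * real n)" by simp
  then show "\<forall>\<^sub>F n in sequentially. ereal (ln (f n) / real n) < y"
    using eventually_gt_at_top[of 0] pos
  proof eventually_elim
    case (elim n)
    \<comment> \<open>Monotonicity of \<open>ln\<close> requires \<open>0 < f n\<close>, which the
      upper bound does not provide.\<close>
    have "ln (f n) \<le> z * real n" using elim(1,3) by (metis ln_exp ln_mono)
    then have "ln (f n) / real n \<le> z" using elim(2) by (simp add: field_simps)
    then show ?case using z(2) by (metis ereal_less_eq(3) order.strict_trans1)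
  qed
qed

context agency
begin

text \<open>A real \<open>Inf\<close> is meaningful only for a nonempty set bounded below. The
  witness \<open>w\<close> and the uniform bound \<open>b\<close> supply both, for general and for
  binary contracts at once.\<close>

lemma cost_sandwich:
  assumes lower: "\<And>w. w \<in> feasible A \<mu> wl u c as n \<Longrightarrow> b \<le> (\<integral>x. w x \<partial>signals \<mu> as n) - W"
    and w: "w \<in> feasible_bin A \<mu> wl u c as n" "(\<integral>x. w x \<partial>signals \<mu> as n) \<le> W + e"
  shows "b \<le> C_SB A \<mu> wl u c as n - W" "C_SB A \<mu> wl u c as n \<le> C_bin A \<mu> wl u c as n"
    "C_bin A \<mu> wl u c as n - W \<le> e"
proof -
  let ?E = "\<lambda>w. \<integral>x. w x \<partial>signals \<mu> as n"
  have sub: "feasible_bin A \<mu> wl u c as n \<subseteq> feasible A \<mu> wl u c as n" by (auto simp: feasible_bin_def)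
  have bdd: "bdd_below (?E ` feasible A \<mu> wl u c as n)"
    by (rule bdd_belowI[where m="b + W"]) (use lower in fastforce)
  have "b + W \<le> C_SB A \<mu> wl u c as n"
    unfolding C_SB_def by (rule cInf_greatest) (use w sub lower in fastforce)+
  then show "b \<le> C_SB A \<mu> wl u c as n - W" by simp
  show "C_SB A \<mu> wl u c as n \<le> C_bin A \<mu> wl u c as n"
    unfolding C_SB_def C_bin_def
    by (rule cInf_superset_mono) (use w(1) sub bdd in auto)
  have "C_bin A \<mu> wl u c as n \<le> ?E w"
    unfolding C_bin_def using w(1) sub by (intro cInf_lower bdd_below_mono[OF bdd]) auto
  then show "C_bin A \<mu> wl u c as n - W \<le> e" using w(2) by simp
qed

end

theorem theorem3:
  fixes A :: "'a set" and as ah :: 'a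
    and X :: "('x::euclidean_space) set" and \<mu> :: "'a \<Rightarrow> 'x measure"
    and wl :: real and u :: "real \<Rightarrow> real" and c :: "'a \<Rightarrow> real"
  assumes finA: "finite A" and as_in: "as \<in> A"
    and prob: "\<And>a. a \<in> A \<Longrightarrow> prob_space (\<mu> a)"
    and sets_mu: "\<And>a. a \<in> A \<Longrightarrow> sets (\<mu> a) = sets (restrict_space borel X)"
    and distinct: "inj_on \<mu> A"
    and abs_cont: "\<And>a a'. a \<in> A \<Longrightarrow> a' \<in> A \<Longrightarrow> absolutely_continuous (\<mu> a) (\<mu> a')"
    and moments: "\<And>a a' l. a \<in> A \<Longrightarrow> a' \<in> A \<Longrightarrow> l > 0 \<Longrightarrow>
        integrable (\<mu> a) (\<lambda>x. enn2real (RN_deriv (\<mu> a) (\<mu> a') x) powr l)"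
    and u_C2: "\<exists>u' u''. (\<forall>w\<in>{wl..}. (u has_real_derivative u' w) (at w within {wl..})
                              \<and> (u' has_real_derivative u'' w) (at w within {wl..})
                              \<and> u' w > 0 \<and> u'' w < 0)
                        \<and> continuous_on {wl..} u''
                        \<and> (u' \<longlongrightarrow> 0) at_top"
    and c_above: "\<exists>a\<in>A. c as > c a"
    and c_ne: "\<And>a. a \<in> A \<Longrightarrow> a \<noteq> as \<Longrightarrow> c as \<noteq> c a"
    and ah_in: "ah \<in> A" and ah_min: "\<And>a. a \<in> A \<Longrightarrow> a \<noteq> ah \<Longrightarrow> c ah < c a"
    and ah_le: "c ah \<le> u wl"
    and lim_u: "\<exists>L. ((\<lambda>w. ereal (u w)) \<longlongrightarrow> L) at_top \<and> ereal (u wl + c as - c ah) < L"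
  shows "(\<forall>\<^sub>F n in sequentially. feasible A \<mu> wl u c as n \<noteq> {}
              \<and> C_SB A \<mu> wl u c as n > C_FB wl u c as ah)
       \<and> ((\<lambda>n. ereal (ln (C_SB A \<mu> wl u c as n - C_FB wl u c as ah) / real n))
             \<longlongrightarrow> - rate X A \<mu> c as ah) sequentially
       \<and> (\<forall>\<^sub>F n in sequentially. feasible_bin A \<mu> wl u c as n \<noteq> {}
              \<and> C_bin A \<mu> wl u c as n > C_FB wl u c as ah)
       \<and> ((\<lambda>n. ereal (ln (C_bin A \<mu> wl u c as n - C_FB wl u c as ah) / real n))
             \<longlongrightarrow> - rate X A \<mu> c as ah) sequentially"
proof -
  obtain u' u'' where u': "\<And>w. w \<ge> wl \<Longrightarrow> (u has_real_derivative u' w) (at w within {wl..})"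
    "\<And>w. w \<ge> wl \<Longrightarrow> (u' has_real_derivative u'' w) (at w within {wl..})"
    "\<And>w. w \<ge> wl \<Longrightarrow> u' w > 0" "\<And>w. w \<ge> wl \<Longrightarrow> u'' w < 0"
    using u_C2 by auto
  have dec: "u' y < u' x" if xy: "wl \<le> x" "x < y" for x y
  proof -
    have "\<exists>z\<in>{x<..<y}. u' y - u' x = (*) (u'' z) (y - x)"
    proof (rule mvt_simple[OF xy(2)])
      fix z assume "x \<le> z" "z \<le> y"
      then show "(u' has_derivative (*) (u'' z)) (at z within {x..y})"
        using u'(2)[of z] xy unfolding has_field_derivative_def by (auto intro: has_derivative_subset)
    qed
    then obtain z where "x < z" "u' y - u' x = u'' z * (y - x)" by auto
    then show ?thesis using u'(4)[of z] xy mult_neg_pos[of "u'' z" "y - x"] by simp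
  qed
  interpret concave_utility wl u u' by unfold_locales (use u' dec in auto)
  have ah_as: "c ah < c as"
    using c_above ah_min[OF as_in] ah_min by (metis less_asym)
  obtain L where L: "((\<lambda>w. ereal (u w)) \<longlongrightarrow> L) at_top" "ereal (u wl + c as - c ah) < L"
    using lim_u by blast
  have "\<forall>\<^sub>F w in at_top. w > wl \<and> ereal (u wl + c as - c ah) < ereal (u w)"
    using eventually_gt_at_top[of wl] order_tendstoD(1)[OF L] by eventually_elim simp
  then obtain w1 where w1: "w1 > wl" "u wl + c as - c ah < u w1"
    using eventually_happens'[OF trivial_limit_at_top_linorder] by auto
  obtain W where W: "wl \<le> W" "u W = u wl + c as - c ah"
    using utility_IVT[of wl w1 "u wl + c as - c ah"] w1 ah_as by auto
  then have W': "wl < W" using ah_as by (cases "W = wl") auto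
  have "inj_on u {wl..}"
  proof (rule linorder_inj_onI)
    fix x y assume "x < y" "x \<in> {wl..}"
    then show "u x \<noteq> u y" using utility_mono[of x y] by simp
  qed auto
  then have FB: "C_FB wl u c as ah = W"
    unfolding C_FB_def using W by (intro the_inv_into_f_eq) auto
  interpret agency wl u u' A \<mu> c as ah W
  proof (intro agency.intro agency_axioms.intro concave_utility_axioms)
    show "sets (\<mu> a) = sets (\<mu> as)" if "a \<in> A" for a using sets_mu[OF that] sets_mu[OF as_in] by simp
    show "u W = u wl + (c as - c ah)" using W(2) by simp
  qed fact+
  define S where "S = {a\<in>A. c a < c as}"
  have S: "finite S" "ah \<in> S" "S \<subseteq> A" using finA ah_in ah_as by (auto simp: S_def)
  \<comment> \<open>One number per cheaper action that serves both sides: it bounds the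
    corresponding term of the rate from above, and all smaller exponents are reached by tests. For
    \<open>ah\<close> an inequality with the Chernoff information is enough.\<close>
  define exponent where "exponent a e \<longleftrightarrow> e > 0 \<and>
      (if a = ah then Chernoff X (\<mu> ah) (\<mu> as) \<le> ereal e else KL (\<mu> a) (\<mu> as) = ereal e) \<and>
      (\<forall>t<e. \<exists>B. test_rate (\<mu> as) (\<mu> a) t B \<and>
         (a = ah \<longrightarrow> (\<lambda>n. exp (t * real n) * measure (iid (\<mu> ah) n) (B n)) \<longlonglongrightarrow> 0))" for a e
  have "\<exists>e. exponent a e" if a: "a \<in> S" for a
  proof -
    have aA: "a \<in> A" using a S by auto
    have ne: "\<mu> as \<noteq> \<mu> a" using a distinct as_in by (auto simp: S_def inj_on_def)
    obtain r where "likelihood_ratio (\<mu> as) (\<mu> a) r"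
      using likelihood_ratio_exists[OF prob[OF as_in] prob[OF aA] sets_eq[OF aA] abs_cont[OF as_in aA]
          abs_cont[OF aA as_in] moments[OF as_in aA]] by blast
    then interpret L: likelihood_ratio "\<mu> as" "\<mu> a" r .
    show ?thesis
    proof (cases "a = ah")
      case True
      obtain s where s: "0 < s" "s < 1" "L.mgf s < 1" "\<And>s'. s' \<in> {0..1} \<Longrightarrow> L.mgf s \<le> L.mgf s'"
        using L.interior_minimizer[OF ne] by blast
      have "- ln (L.mgf s) > 0" using s L.mgf_pos[of s] by simp
      moreover have "Chernoff X (\<mu> a) (\<mu> as) \<le> ereal (- ln (L.mgf s))"
        by (rule Chernoff_le[OF L.likelihood_ratio_axioms sets_mu[OF as_in] s(1,2,4)])
      ultimately show ?thesis
        using L.chernoff_test_rate[OF s(1-3)] True unfolding exponent_def by (intro exI[of _ "- ln (L.mgf s)"]) auto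
    next
      case False
      then show ?thesis
        using L.KL_eq L.KL_pos[OF ne] L.stein_test_rate[OF ne] unfolding exponent_def by (intro exI[of _ "\<integral>x. ln (r x) \<partial>\<mu> a"]) auto
    qed
  qed
  then obtain e where ex: "\<And>a. a \<in> S \<Longrightarrow> exponent a (e a)" by metis
  have e_pos: "\<forall>a\<in>S. 0 < e a" using ex by (simp add: exponent_def)
  have e_Chernoff: "Chernoff X (\<mu> ah) (\<mu> as) \<le> ereal (e ah)" using ex[OF S(2)] by (simp add: exponent_def)
  have e_KL: "KL (\<mu> a) (\<mu> as) = ereal (e a)" if "a \<in> S - {ah}" for a
    using ex[of a] that by (simp add: exponent_def)
  have e_test: "\<exists>B. test_rate (\<mu> as) (\<mu> a) t B \<and>
      (a = ah \<longrightarrow> (\<lambda>n. exp (t * real n) * measure (iid (\<mu> ah) n) (B n)) \<longlonglongrightarrow> 0)" if "a \<in> S" "t < e a" for a t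
    using ex[OF that(1)] that(2) by (simp add: exponent_def)
  let ?\<rho> = "rate X A \<mu> c as ah"
  have rate_le: "?\<rho> \<le> ereal (e a)" if "a \<in> S" for a
  proof (cases "a = ah")
    case True
    then show ?thesis unfolding rate_def using e_Chernoff by (auto intro: min.coboundedI1)
  next
    case False
    then have "(INF a\<in>{a\<in>A. c a < c as} - {ah}. KL (\<mu> a) (\<mu> as)) \<le> ereal (e a)"
      using e_KL[of a] that by (intro INF_lower2[of a]) (auto simp: S_def)
    then show ?thesis unfolding rate_def by (auto intro: min.coboundedI2)
  qed
  have upper: "\<forall>\<^sub>F n in sequentially. \<exists>w\<in>feasible_bin A \<mu> wl u c as n.
      (\<integral>x. w x \<partial>signals \<mu> as n) \<le> W + exp (- t * real n)" if t: "\<forall>a\<in>S. t < e a" for t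
  proof -
    have "\<forall>a\<in>S. \<exists>B. test_rate (\<mu> as) (\<mu> a) t B \<and>
         (a = ah \<longrightarrow> (\<lambda>n. exp (t * real n) * measure (iid (\<mu> ah) n) (B n)) \<longlonglongrightarrow> 0)"
      using e_test t by blast
    then obtain B where B: "\<And>a. a \<in> S \<Longrightarrow> test_rate (\<mu> as) (\<mu> a) t (B a)"
      "(\<lambda>n. exp (t * real n) * measure (iid (\<mu> ah) n) (B ah n)) \<longlonglongrightarrow> 0"
      using S(2) by (auto dest!: bchoice)
    show ?thesis
    proof (rule excess_upper)
      fix a assume "a \<in> A" "c a < c as"
      then have "a \<in> S" by (simp add: S_def)
      then show "test_rate (\<mu> as) (\<mu> a) t (\<lambda>n. \<Inter>a\<in>S. B a n)"
        by (intro test_rate_combine prob as_in S(1) B(1)) (use S sets_eq in auto)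
    next
      have "measure (iid (\<mu> ah) n) (\<Inter>a\<in>S. B a n) \<le> measure (iid (\<mu> ah) n) (B ah n)" for n
      proof -
        interpret T: prob_space "iid (\<mu> ah) n" by (rule prob_space_iid) (rule prob[OF ah_in])
        have "sets (iid (\<mu> ah) n) = sets (iid (\<mu> as) n)" by (intro sets_PiM_cong) (auto simp: sets_eq[OF ah_in])
        then show ?thesis using B(1)[OF S(2)] S(2)
          by (intro T.finite_measure_mono) (auto simp: test_rate_def)
      qed
      then show "(\<lambda>n. exp (t * real n) * measure (iid (\<mu> ah) n) (\<Inter>a\<in>S. B a n)) \<longlonglongrightarrow> 0"
        by (intro tendsto_sandwich[OF _ _ tendsto_const B(2)]) simp_all
    qed
  qed
  have lower: "\<forall>\<^sub>F n in sequentially. \<forall>w\<in>feasible A \<mu> wl u c as n.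
      exp (- t * real n) \<le> (\<integral>x. w x \<partial>signals \<mu> as n) - W" if t: "?\<rho> < ereal t" for t
  proof -
    \<comment> \<open>Strictness of \<open>t\<close> leaves room for some \<open>s < t\<close>, and
      the gap between the two exponents absorbs the constant \<open>C\<close>.\<close>
    have "\<exists>C>0. \<exists>s<t. \<forall>\<^sub>F n in sequentially. \<forall>w\<in>feasible A \<mu> wl u c as n.
      C * exp (- s * real n) \<le> (\<integral>x. w x \<partial>signals \<mu> as n) - W"
    proof (cases "Chernoff X (\<mu> ah) (\<mu> as) < ereal t")
      case True
      then obtain N where N: "N \<in> prob_measures_on X" "max (KL N (\<mu> ah)) (KL N (\<mu> as)) < ereal t"
        unfolding Chernoff_def by (auto simp: INF_less_iff)
      obtain s where s: "max (KL N (\<mu> ah)) (KL N (\<mu> as)) < ereal s" "ereal s < ereal t"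
        using ereal_dense2[OF N(2)] by blast
      have "prob_space N" "sets N = sets (\<mu> as)" using N(1) sets_mu[OF as_in] by (auto simp: prob_measures_on_def)
      from excess_lower_Chernoff[OF this] s show ?thesis by fastforce
    next
      case False
      then obtain a where a: "a \<in> S - {ah}" "KL (\<mu> a) (\<mu> as) < ereal t"
        using t unfolding rate_def by (auto simp: min_less_iff_disj INF_less_iff S_def)
      then obtain s where s: "KL (\<mu> a) (\<mu> as) < ereal s" "ereal s < ereal t"
        using ereal_dense2 by blast
      \<comment> \<open>The divergence is the positive number \<open>e a\<close>, so
        \<open>s\<close> meets the sign condition of the Stein bound.\<close>
      have "0 \<le> s" using s(1) e_pos[THEN bspec, of a] e_KL[OF a(1)] a(1) by simp
      with excess_lower_Stein[of a s] s a show ?thesis by (auto simp: S_def)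
    qed
    then obtain C s where C: "C > 0" "s < t" "\<forall>\<^sub>F n in sequentially. \<forall>w\<in>feasible A \<mu> wl u c as n.
      C * exp (- s * real n) \<le> (\<integral>x. w x \<partial>signals \<mu> as n) - W" by blast
    show ?thesis using C(3) exp_decay_eventually[OF C(1,2)] by eventually_elim force
  qed
  have sandwich: "\<forall>\<^sub>F n in sequentially. feasible_bin A \<mu> wl u c as n \<noteq> {}
      \<and> exp (- t * real n) \<le> C_SB A \<mu> wl u c as n - W
      \<and> C_SB A \<mu> wl u c as n \<le> C_bin A \<mu> wl u c as n
      \<and> C_bin A \<mu> wl u c as n - W \<le> exp (- s * real n)"
    if "?\<rho> < ereal t" "\<forall>a\<in>S. s < e a" for t s
    using lower[OF that(1)] upper[OF that(2)]
  proof eventually_elim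
    case (elim n)
    then obtain w where w: "w \<in> feasible_bin A \<mu> wl u c as n"
      "(\<integral>x. w x \<partial>signals \<mu> as n) \<le> W + exp (- s * real n)" by auto
    then show ?case using cost_sandwich[OF _ w] elim(1) by blast
  qed
  \<comment> \<open>The rate is at most \<open>e ah\<close>, so \<open>e ah + 1\<close> is a real
    exponent beyond it.\<close>
  have t0: "?\<rho> < ereal (e ah + 1)"
    using rate_le[OF S(2)] by (rule order.strict_trans1) simp
  \<comment> \<open>Exponent 0 is admissible on the upper side by \<open>e_pos\<close>; what is
    extracted is existence of contracts and a strictly positive lower bound.\<close>
  have pos: "\<forall>\<^sub>F n in sequentially. feasible_bin A \<mu> wl u c as n \<noteq> {}
      \<and> 0 < C_SB A \<mu> wl u c as n - W \<and> 0 < C_bin A \<mu> wl u c as n - W"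
    using sandwich[OF t0 e_pos] by eventually_elim (smt (verit) exp_gt_zero)
  have lo: "\<forall>\<^sub>F n in sequentially. exp (- t * real n) \<le> C_SB A \<mu> wl u c as n - W
      \<and> exp (- t * real n) \<le> C_bin A \<mu> wl u c as n - W" if "?\<rho> < ereal t" for t
    using sandwich[OF that e_pos] by eventually_elim linarith
  have up: "\<forall>\<^sub>F n in sequentially. C_SB A \<mu> wl u c as n - W \<le> exp (- t * real n)
      \<and> C_bin A \<mu> wl u c as n - W \<le> exp (- t * real n)" if t: "ereal t < ?\<rho>" for t
  proof -
    have "\<forall>a\<in>S. t < e a"
    proof
      fix a assume "a \<in> S"
      then show "t < e a" using order.strict_trans2[OF t rate_le] by simp
    qed
    from sandwich[OF t0 this] show ?thesis by eventually_elim linarith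
  qed
  have "(\<lambda>n. ereal (ln (C_SB A \<mu> wl u c as n - W) / real n)) \<longlonglongrightarrow> - ?\<rho>"
    by (rule exponential_rate_tendsto)
      (use lo up pos in \<open>simp_all add: eventually_conj_iff\<close>)
  moreover have "(\<lambda>n. ereal (ln (C_bin A \<mu> wl u c as n - W) / real n)) \<longlonglongrightarrow> - ?\<rho>"
    by (rule exponential_rate_tendsto)
      (use lo up pos in \<open>simp_all add: eventually_conj_iff\<close>)
  moreover have "\<forall>\<^sub>F n in sequentially. feasible A \<mu> wl u c as n \<noteq> {}"
    using pos by eventually_elim (auto simp: feasible_bin_def)
  ultimately show ?thesis
    unfolding FB using pos by (simp add: eventually_conj_iff)
qed

end
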